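(* Let $0<p\le2$ and suppose $\mu,\nu\in\mathcal{P}_\alpha(\mathbb{R}^d)$ with $0<\alpha<1$. If $f,g$ are the solutions of the heat-diffusion equation $\frac{\partial f}{\partial t}+\Lambda^pf=0$ on $\mathbb{R}^d\times(0,\infty)$ with the initial data $\mu,\nu$, respectively, then $$\|\partial^\sigma(f-g)(\cdot,t)\|_\infty\le A_\sigma\,t^{-(\alpha+d+|\sigma|)/p}\,\rho_\alpha(\mu,\nu)$$ for every multi-index $\sigma\in\mathbb{Z}_+^d$ and $t>0$, where $A_\sigma$ denotes the optimal bound $$A_\sigma=(2\pi)^{-d}\left(\frac{\alpha+d+|\sigma|}{ep}\right)^{\frac{\alpha+d+|\sigma|}{p}}.$$
   Context: Let $d\ge1$ and let $|\cdot|$ denote the Euclidean norm on $\mathbb{R}^d$; for a multi-index $\sigma\in\mathbb{Z}_+^d$, $|\sigma|=\sigma_1+\cdots+\sigma_d$. $\mathcal{P}(\mathbb{R}^d)$ is the set of Borel probability measures on $\mathbb{R}^d$ and $\mathcal{P}_\alpha(\mathbb{R}^d)=\{\mu\in\mathcal{P}(\mathbb{R}^d):\int_{\mathbb{R}^d}|v|^\alpha d\mu(v)<\infty\}$. The Fourier transform of $\mu$ is $\widehat\mu(\xi)=\int_{\mathbb{R}^d}e^{-i\xi\cdot v}d\mu(v)$. $\Lambda^p$ is the operator with $(\Lambda^pg)^{\wedge}(\xi)=|\xi|^p\widehat g(\xi)$. The solution of $\frac{\partial f}{\partial t}+\Lambda^pf=0$ with initial datum $\mu\in\mathcal{P}(\mathbb{R}^d)$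 means the function $$f(x,t)=\int_{\mathbb{R}^d}E_p(x-y,t)\,d\mu(y)\quad(x\in\mathbb{R}^d,\ t>0),$$ where $E_p(x,t)=t^{-d/p}E_p(t^{-1/p}x)$ and $E_p(v)=(2\pi)^{-d}\int_{\mathbb{R}^d}e^{iv\cdot\xi-|\xi|^p}d\xi$; equivalently, $\widehat f(\xi,t)=e^{-t|\xi|^p}\widehat\mu(\xi)$, where $\widehat f(\cdot,t)$ is the Fourier transform in $x$. Derivatives $\partial^\sigma$ are in the variable $x$, $\|\cdot\|_\infty$ is the supremum norm over $x\in\mathbb{R}^d$, and $$\rho_\alpha(\mu,\nu)=\int_{\mathbb{R}^d}\frac{|\widehat\mu(\xi)-\widehat\nu(\xi)|}{|\xi|^{d+\alpha}}\,d\xi .$$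
   Formalization: "Optimal" is taken as: A_σ is the least constant valid for all multi-indices of the same order |σ|, all μ, ν and all t; for each single σ it is false when d ≥ 2 (for σ=(1,1), |ξ₁ξ₂| ≤ |ξ|²/2, so A_σ/2 already works). *)

theory Defs
  imports "HOL-Analysis.Analysis" "HOL-Probability.Probability"
begin

definition prob_moment :: "real \<Rightarrow> (real ^ 'd) measure set" where
  "prob_moment \<alpha> = {\<mu>. prob_space \<mu> \<and> sets \<mu> = sets borel \<and> integrable \<mu> (\<lambda>v. norm v powr \<alpha>)}"

definition fourier :: "(real ^ 'd) measure \<Rightarrow> real ^ 'd \<Rightarrow> complex" where
  "fourier \<mu> \<xi> = (\<integral>v. exp (- (\<i> * complex_of_real (\<xi> \<bullet> v))) \<partial>\<mu>)"

text \<open>The metric may take the value infinity. The integrand is set to 0 at the origin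
  (division by zero), which is a null set.\<close>

definition rho :: "real \<Rightarrow> (real ^ 'd) measure \<Rightarrow> (real ^ 'd) measure \<Rightarrow> ennreal" where
  "rho \<alpha> \<mu> \<nu> = (\<integral>\<^sup>+\<xi>. ennreal (norm (fourier \<mu> \<xi> - fourier \<nu> \<xi>)
                        / norm \<xi> powr (real CARD('d) + \<alpha>)) \<partial>lborel)"

definition heat_profile :: "real \<Rightarrow> real ^ 'd \<Rightarrow> complex" where
  "heat_profile p v = complex_of_real ((2 * pi) powr (- real CARD('d))) *
     (\<integral>\<xi>. exp (\<i> * complex_of_real (v \<bullet> \<xi>) - complex_of_real (norm \<xi> powr p)) \<partial>lborel)"

definition heat_kernel :: "real \<Rightarrow> real ^ 'd \<Rightarrow> real \<Rightarrow> complex" where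
  "heat_kernel p x t = complex_of_real (t powr (- real CARD('d) / p)) *
     heat_profile p (t powr (- 1 / p) *\<^sub>R x)"

definition heat_solution :: "real \<Rightarrow> (real ^ 'd) measure \<Rightarrow> real ^ 'd \<Rightarrow> real \<Rightarrow> complex" where
  "heat_solution p \<mu> x t = (\<integral>y. heat_kernel p (x - y) t \<partial>\<mu>)"

definition partial_deriv :: "'d \<Rightarrow> (real ^ 'd \<Rightarrow> complex) \<Rightarrow> real ^ 'd \<Rightarrow> complex" where
  "partial_deriv i h x = vector_derivative (\<lambda>s. h (x + s *\<^sub>R axis i 1)) (at 0)"

primrec iter_partial :: "'d list \<Rightarrow> (real ^ 'd \<Rightarrow> complex) \<Rightarrow> real ^ 'd \<Rightarrow> complex" where
  "iter_partial [] h = h"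
| "iter_partial (i # is) h = partial_deriv i (iter_partial is h)"

definition smooth :: "(real ^ 'd \<Rightarrow> complex) \<Rightarrow> bool" where
  "smooth h \<longleftrightarrow> (\<forall>is. continuous_on UNIV (iter_partial is h) \<and>
     (\<forall>i x. (\<lambda>s. iter_partial is h (x + s *\<^sub>R axis i 1)) differentiable (at (0::real))))"

text \<open>The index type carries no order, so the sequence of differentiations realising a
  multi-index is chosen arbitrarily. For smooth functions the choice is immaterial, by the
  symmetry of mixed partial derivatives; for other functions the value may be meaningless.\<close>

definition multi_deriv :: "('d \<Rightarrow> nat) \<Rightarrow> (real ^ 'd \<Rightarrow> complex) \<Rightarrow> real ^ 'd \<Rightarrow> complex" where
  "multi_deriv \<sigma> h = iter_partial (SOME is. \<forall>i. count_list is i = \<sigma> i) h"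

lemma multi_index_list_exists: "\<exists>is. \<forall>i. count_list is i = (\<sigma> :: 'd::finite \<Rightarrow> nat) i"
proof -
  obtain xs where "mset xs = Abs_multiset \<sigma>"
    using ex_mset by blast
  moreover have "count (Abs_multiset \<sigma>) = \<sigma>"
    by (simp add: count_Abs_multiset)
  ultimately show ?thesis
    by (metis count_mset)
qed

definition multi_order :: "('d::finite \<Rightarrow> nat) \<Rightarrow> nat" where
  "multi_order \<sigma> = (\<Sum>i\<in>UNIV. \<sigma> i)"

definition sup_norm :: "(real ^ 'd \<Rightarrow> complex) \<Rightarrow> ennreal" where
  "sup_norm h = (SUP x. ennreal (norm (h x)))"

text \<open>The constant is the maximum over \<open>r > 0\<close> of
  \<open>(2\<pi>)\<^sup>-\<^sup>d r\<^sup>a exp (- r\<^sup>p)\<close>, where \<open>a = \<alpha> + d + |\<sigma>|\<close>. It depends on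
  \<open>\<sigma>\<close> only through its order.\<close>

definition A_const :: "real \<Rightarrow> real \<Rightarrow> ('d::finite \<Rightarrow> nat) \<Rightarrow> real" where
  "A_const p \<alpha> \<sigma> = (2 * pi) powr (- real CARD('d)) *
     ((\<alpha> + real CARD('d) + real (multi_order \<sigma>)) / (exp 1 * p))
       powr ((\<alpha> + real CARD('d) + real (multi_order \<sigma>)) / p)"

end

theory Submission
  imports Defs
begin

text \<open>On the Fourier side the flow multiplies by \<open>exp (- t |\<xi>|\<^sup>p)\<close>, so by Fubini the difference of the two
solutions is the Fourier synthesis of
\<open>(2\<pi>)\<^sup>-\<^sup>d exp (- t |\<xi>|\<^sup>p) D(\<xi>)\<close>, where \<open>D\<close> is the difference of the Fourier transforms of the initial
data (\<open>heat_difference_eq_fourier_synthesis\<close>). No Fourier inversion is involved: the kernel is given as an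
inverse transform. The multiplier beats every power of \<open>|\<xi>|\<close>, so differentiation under the
integral is legitimate to any order and inserts the factor \<open>(i\<xi>)\<^sup>\<sigma>\<close>.

Upper bound. With \<open>a = \<alpha> + d + |\<sigma>|\<close> one has
\<open>|\<xi>\<^sup>\<sigma>| exp (- t |\<xi>|\<^sup>p) |D| \<le> (|\<xi>|\<^sup>a exp (- t |\<xi>|\<^sup>p)) (|D| / |\<xi>|\<^sup>d\<^sup>+\<^sup>\<alpha>)\<close>, and the first factor is
maximal where \<open>|\<xi>|\<^sup>p = a/(pt)\<close>, with value \<open>(a/(ept))\<close> to the power \<open>a/p\<close> (\<open>powr_mult_exp_le\<close>). Integrating
gives the estimate.

Optimality. Both inequalities become equalities in the limit when \<open>D\<close> concentrates at points \<open>\<xi>\<close> of the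
maximising radius \<open>r\<close> on a coordinate axis, provided all derivatives fall on that coordinate and the phases
of the concentration points agree. Since \<open>D\<close> comes from a real measure, it must concentrate at
the pair \<open>\<plusminus>r e\<^sub>i\<close>; a wide Gaussian times \<open>cos (r v\<^sub>i)\<close> does that. Two further demands are that the measure has
total mass zero and that \<open>\<rho>\<^sub>\<alpha>\<close> is finite; for both, the density is differenced \<open>d + 1\<close> times with step
\<open>(\<pi>/r) e\<^sub>i\<close>. On the Fourier side this multiplies by a function that vanishes to order \<open>d + 1 > d + \<alpha>\<close> at the
origin and takes the same value \<open>2\<^sup>d\<^sup>+\<^sup>1\<close> at both peaks (\<open>exists_twin_peak_spectrum\<close>). Finally, evaluating the
derivative at the point \<open>x = - (k\<pi>/(2r)) e\<^sub>i\<close>, where \<open>k = |\<sigma>|\<close>, cancels the phase \<open>(\<plusminus>i)\<^sup>k\<close> at the two peaks, so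
that their contributions add up (\<open>A_const_le_of_estimate\<close>).\<close>

section \<open>Integration over Euclidean space\<close>

lemma lborel_nn_integral_affine:
  fixes a :: "'a::euclidean_space" and f :: "'a \<Rightarrow> ennreal"
  assumes [measurable]: "f \<in> borel_measurable borel" and c: "c \<noteq> 0"
  shows "(\<integral>\<^sup>+x. f x \<partial>lborel) = ennreal (\<bar>c\<bar> ^ DIM('a)) * (\<integral>\<^sup>+x. f (a + c *\<^sub>R x) \<partial>lborel)"
  by (subst lborel_affine[OF c, of a])
     (simp add: nn_integral_density nn_integral_distr nn_integral_cmult)

lemma lborel_integrable_affine:
  fixes a :: "'a::euclidean_space" and f :: "'a \<Rightarrow> 'b::{banach, second_countable_topology}"
  assumes f: "integrable lborel f" and c: "c \<noteq> 0"
  shows "integrable lborel (\<lambda>x. f (a + c *\<^sub>R x))"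
proof -
  have [measurable]: "f \<in> borel_measurable borel"
    using f by auto
  have "(\<integral>\<^sup>+x. norm (f x) \<partial>lborel) = ennreal (\<bar>c\<bar> ^ DIM('a)) * (\<integral>\<^sup>+x. norm (f (a + c *\<^sub>R x)) \<partial>lborel)"
    by (rule lborel_nn_integral_affine) (use c in auto)
  moreover have "(\<integral>\<^sup>+x. norm (f x) \<partial>lborel) < \<infinity>"
    using f by (simp add: integrable_iff_bounded)
  moreover have "ennreal (\<bar>c\<bar> ^ DIM('a)) \<noteq> 0"
    using c by simp
  ultimately have "(\<integral>\<^sup>+x. norm (f (a + c *\<^sub>R x)) \<partial>lborel) < \<infinity>"
    by (auto simp: ennreal_mult_less_top)
  then show ?thesis
    by (simp add: integrable_iff_bounded)
qed

lemma lborel_integral_affine: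
  fixes a :: "'a::euclidean_space" and f :: "'a \<Rightarrow> 'b::{banach, second_countable_topology}"
  assumes [measurable]: "f \<in> borel_measurable borel" and c: "c \<noteq> 0"
  shows "(\<integral>x. f x \<partial>lborel) = \<bar>c\<bar> ^ DIM('a) *\<^sub>R (\<integral>x. f (a + c *\<^sub>R x) \<partial>lborel)"
  by (subst lborel_affine[OF c, of a])
     (simp add: integral_density integral_distr)

text \<open>Lebesgue measure on a Euclidean space is the image of the product of one-dimensional Lebesgue measures,
  so Fubini for finite products applies in coordinates.\<close>

lemma
  fixes f :: "'a::euclidean_space \<Rightarrow> real \<Rightarrow> 'b::{real_normed_field,banach,second_countable_topology}"
  assumes f: "\<And>b. b \<in> Basis \<Longrightarrow> integrable lborel (f b)"
  shows lborel_integrable_prod: "integrable lborel (\<lambda>x. \<Prod>b\<in>Basis. f b (x \<bullet> b))"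
    and lborel_integral_prod: "(\<integral>x. (\<Prod>b\<in>Basis. f b (x \<bullet> b)) \<partial>lborel) = (\<Prod>b\<in>Basis. \<integral>x. f b x \<partial>lborel)"
proof -
  have [measurable]: "f b \<in> borel_measurable borel" if "b \<in> Basis" for b
    using f[OF that] by auto
  interpret product_sigma_finite "\<lambda>b::'a. lborel :: real measure"
    by standard
  have *: "(\<Prod>b\<in>Basis. f b ((\<Sum>j\<in>Basis. x j *\<^sub>R j) \<bullet> b)) = (\<Prod>b\<in>Basis. f b (x b))" for x
    by (intro prod.cong) auto
  have m: "(\<lambda>f. \<Sum>b\<in>Basis. f b *\<^sub>R b) \<in> (\<Pi>\<^sub>M (b::'a)\<in>Basis. lborel) \<rightarrow>\<^sub>M borel"
    by measurable
  have m': "(\<lambda>x. \<Prod>b\<in>Basis. f b (x \<bullet> b)) \<in> borel_measurable borel"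
    by measurable
  show "integrable lborel (\<lambda>x. \<Prod>b\<in>Basis. f b (x \<bullet> b))"
    by (subst lborel_eq) (auto simp: integrable_distr_eq[OF m m'] * intro!: product_integrable_prod f)
  show "(\<integral>x. (\<Prod>b\<in>Basis. f b (x \<bullet> b)) \<partial>lborel) = (\<Prod>b\<in>Basis. \<integral>x. f b x \<partial>lborel)"
    by (subst lborel_eq) (auto simp: integral_distr[OF m m'] * intro!: product_integral_prod f)
qed

lemma lborel_integral_pos:
  fixes f :: "'a::euclidean_space \<Rightarrow> real"
  assumes f: "integrable lborel f" and pos: "\<And>x. 0 < f x"
  shows "0 < (\<integral>x. f x \<partial>lborel)"
proof -
  have "(\<integral>x. f x \<partial>lborel) \<noteq> 0"
  proof
    assume "(\<integral>x. f x \<partial>lborel) = 0"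
    then have "AE x in lborel. f x = 0"
      using integral_nonneg_eq_0_iff_AE[OF f] pos by (simp add: less_imp_le)
    then have "AE x in (lborel :: 'a measure). False"
      by eventually_elim (metis pos less_irrefl)
    then show False by (simp add: AE_iff_null emeasure_lborel_UNIV null_sets_def)
  qed
  moreover have "0 \<le> (\<integral>x. f x \<partial>lborel)"
    by (intro Bochner_Integration.integral_nonneg less_imp_le pos)
  ultimately show ?thesis by simp
qed

section \<open>The radial maximum and the heat multiplier\<close>

text \<open>With \<open>u = (tp/a) r\<^sup>p\<close> this is the elementary \<open>u exp (-u) \<le> 1/e\<close> raised to the power \<open>a/p\<close>.
  The bound is sharp; it is the source of the constant in the theorem.\<close>

lemma powr_mult_exp_le:
  fixes r a t p :: real
  assumes "0 \<le> r" "0 < a" "0 < t" "0 < p"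
  shows "r powr a * exp (- t * r powr p) \<le> (a / (exp 1 * p * t)) powr (a / p)"
proof (cases "r = 0")
  case False
  with assms have r: "0 < r" by simp
  define u where "u = t * p / a * r powr p"
  have u: "0 < u" using assms r by (simp add: u_def)
  have "u * exp (- u) \<le> exp (- 1)"
    using mult_right_mono[OF exp_ge_add_one_self[of "u - 1"], of "exp (- u)"]
    by (simp add: exp_add[symmetric])
  then have "(u * exp (- u)) powr (a / p) \<le> exp (- 1) powr (a / p)"
    using u assms by (intro powr_mono2) auto
  moreover have "(u * exp (- u)) powr (a / p) = (t * p / a) powr (a / p) * (r powr a * exp (- t * r powr p))"
  proof -
    have "exp (- u) powr (a / p) = exp (- t * r powr p)"
      using assms by (simp add: exp_powr_real u_def)
    moreover have "u powr (a / p) = (t * p / a) powr (a / p) * r powr a"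
      unfolding u_def using assms by (subst powr_mult) (auto simp: powr_powr)
    ultimately show ?thesis
      using u by (simp add: powr_mult)
  qed
  ultimately have "r powr a * exp (- t * r powr p) \<le> exp (- 1) powr (a / p) / (t * p / a) powr (a / p)"
    using assms by (simp add: field_simps)
  also have "\<dots> = (exp (- 1) / (t * p / a)) powr (a / p)"
    using assms by (subst powr_divide) auto
  also have "exp (- 1) / (t * p / a) = a / (exp 1 * p * t)"
    using assms by (simp add: exp_minus field_simps)
  finally show ?thesis .
qed (use assms in auto)

lemma powr_mult_exp_eq:
  fixes a p :: real
  assumes "0 < a" "0 < p"
  defines "r \<equiv> (a / p) powr (1 / p)"
  shows "r powr a * exp (- (r powr p)) = (a / (exp 1 * p)) powr (a / p)"
proof -
  have "r powr p = a / p" using assms by (simp add: powr_powr)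
  moreover have "r powr a = (a / p) powr (a / p)" by (simp add: r_def powr_powr)
  moreover have "exp (- (a / p)) = exp (-1) powr (a / p)" by (simp add: exp_powr_real)
  ultimately have "r powr a * exp (- (r powr p)) = (a / p * exp (-1)) powr (a / p)"
    using assms by (simp add: powr_mult[symmetric])
  also have "a / p * exp (-1) = a / (exp 1 * p)"
    by (simp add: exp_minus field_simps)
  finally show ?thesis .
qed

lemma pow_mult_exp_bounded:
  fixes t p :: real
  assumes "0 < t" "0 < p"
  shows "\<exists>B\<ge>0. \<forall>r\<ge>0. r ^ k * exp (- t * r powr p) \<le> B"
proof (cases "k = 0")
  case True
  then show ?thesis using assms by (intro exI[of _ 1]) auto
next
  case False
  have "r ^ k * exp (- t * r powr p) \<le> (real k / (exp 1 * p * t)) powr (real k / p)" if "r \<ge> 0" for r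
    using powr_mult_exp_le[of r "real k" t p] that assms False
    by (cases "r = 0") (auto simp: powr_realpow zero_power)
  then show ?thesis by (intro exI[of _ "(real k / (exp 1 * p * t)) powr (real k / p)"]) auto
qed

lemma integrable_prod_inverse_1_plus_square:
  "integrable lborel (\<lambda>\<xi>::'a::euclidean_space. \<Prod>b\<in>Basis. 1 / (1 + (\<xi> \<bullet> b)\<^sup>2))"
proof -
  have "integrable lborel (\<lambda>x::real. 1 / (1 + x\<^sup>2))"
    using integrable_inverse_1_plus_square
    by (simp add: set_integrable_def inverse_eq_divide)
  then show ?thesis by (rule lborel_integrable_prod)
qed

text \<open>The exponential absorbs \<open>(1 + |\<xi>|\<^sup>2)\<^sup>d\<close>, which dominates the product of the \<open>1 + \<xi>\<^sub>b\<^sup>2\<close>. The integrand is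
  therefore bounded by a multiple of a product of integrable one-variable functions.
  This covers small \<open>p\<close>, where a comparison with a Gaussian would fail.\<close>

lemma integrable_norm_pow_mult_exp:
  fixes t p :: real
  assumes "0 < t" "0 < p"
  shows "integrable lborel (\<lambda>\<xi>::'a::euclidean_space. norm \<xi> ^ k * exp (- t * norm \<xi> powr p))"
proof -
  let ?d = "DIM('a)"
  obtain B0 where B0: "\<And>r. r \<ge> 0 \<Longrightarrow> r ^ k * exp (- t * r powr p) \<le> B0"
    using pow_mult_exp_bounded[OF assms] by blast
  obtain B1 where B1: "\<And>r. r \<ge> 0 \<Longrightarrow> r ^ (k + 2 * ?d) * exp (- t * r powr p) \<le> B1"
    using pow_mult_exp_bounded[OF assms] by blast
  define B where "B = 2 ^ ?d * (B0 + B1)"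
  have bound: "norm \<xi> ^ k * exp (- t * norm \<xi> powr p) \<le> B * (\<Prod>b\<in>Basis. 1 / (1 + (\<xi> \<bullet> b)\<^sup>2))" for \<xi> :: 'a
  proof -
    let ?P = "\<Prod>b\<in>Basis. (1 + (\<xi> \<bullet> b)\<^sup>2)"
    have Ppos: "0 < ?P" by (intro prod_pos) (auto intro: add_pos_nonneg)
    have "?P \<le> (\<Prod>b\<in>(Basis::'a set). 1 + (norm \<xi>)\<^sup>2)"
      by (intro prod_mono) (auto intro!: add_mono simp: abs_le_square_iff[symmetric] Basis_le_norm)
    also have "\<dots> = (1 + (norm \<xi>)\<^sup>2) ^ ?d" by simp
    also have "\<dots> \<le> 2 ^ ?d * (1 + norm \<xi> ^ (2 * ?d))"
    proof (cases "norm \<xi> \<le> 1")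
      case True
      then have "(1 + (norm \<xi>)\<^sup>2) ^ ?d \<le> 2 ^ ?d"
        by (intro power_mono) (auto simp: power_le_one)
      also have "\<dots> \<le> 2 ^ ?d * (1 + norm \<xi> ^ (2 * ?d))" by simp
      finally show ?thesis .
    next
      case False
      then have "1 + (norm \<xi>)\<^sup>2 \<le> 2 * (norm \<xi>)\<^sup>2" by simp
      then have "(1 + (norm \<xi>)\<^sup>2) ^ ?d \<le> (2 * (norm \<xi>)\<^sup>2) ^ ?d"
        by (intro power_mono) auto
      also have "\<dots> = 2 ^ ?d * norm \<xi> ^ (2 * ?d)" by (simp add: power_mult_distrib power_mult)
      also have "\<dots> \<le> 2 ^ ?d * (1 + norm \<xi> ^ (2 * ?d))" by simp
      finally show ?thesis .
    qed
    finally have P: "?P \<le> 2 ^ ?d * (1 + norm \<xi> ^ (2 * ?d))" .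
    have "(norm \<xi> ^ k * exp (- t * norm \<xi> powr p)) * ?P
        \<le> (norm \<xi> ^ k * exp (- t * norm \<xi> powr p)) * (2 ^ ?d * (1 + norm \<xi> ^ (2 * ?d)))"
      by (rule mult_left_mono[OF P]) auto
    also have "\<dots> = 2 ^ ?d * (norm \<xi> ^ k * exp (- t * norm \<xi> powr p) + norm \<xi> ^ (k + 2 * ?d) * exp (- t * norm \<xi> powr p))"
      by (simp add: algebra_simps power_add)
    also have "\<dots> \<le> B" unfolding B_def
      by (intro mult_left_mono add_mono B0 B1) auto
    finally show ?thesis using Ppos
      by (simp add: prod_dividef field_simps)
  qed
  show ?thesis
  proof (rule Bochner_Integration.integrable_bound)
    show "integrable lborel (\<lambda>\<xi>::'a. B * (\<Prod>b\<in>Basis. 1 / (1 + (\<xi> \<bullet> b)\<^sup>2)))"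
      by (intro integrable_mult_right integrable_prod_inverse_1_plus_square)
    show "AE \<xi> in lborel. norm (norm (\<xi>::'a) ^ k * exp (- t * norm \<xi> powr p)) \<le> norm (B * (\<Prod>b\<in>Basis. 1 / (1 + (\<xi> \<bullet> b)\<^sup>2)))"
      using bound by (auto intro!: AE_I2 order.trans[OF _ abs_ge_self])
  qed auto
qed

section \<open>Fourier synthesis of rapidly decaying spectra\<close>

text \<open>Decay of \<open>G\<close> is measured by absolute moments, because the \<open>k\<close>-th moment is what \<open>k\<close>
  derivatives of the synthesised function cost.\<close>

definition rapidly_decaying :: "(real ^ 'd \<Rightarrow> complex) \<Rightarrow> bool" where
  "rapidly_decaying G \<longleftrightarrow> G \<in> borel_measurable borel \<and>
     (\<forall>k. integrable lborel (\<lambda>\<xi>. norm \<xi> ^ k * norm (G \<xi>)))"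

definition fourier_synthesis :: "(real ^ 'd \<Rightarrow> complex) \<Rightarrow> real ^ 'd \<Rightarrow> complex" where
  "fourier_synthesis G x = (\<integral>\<xi>. exp (\<i> * complex_of_real (x \<bullet> \<xi>)) * G \<xi> \<partial>lborel)"

lemma rapidly_decaying_measurable [measurable_dest]:
  "rapidly_decaying G \<Longrightarrow> G \<in> borel_measurable borel"
  by (simp add: rapidly_decaying_def)

lemma rapidly_decayingD:
  "rapidly_decaying G \<Longrightarrow> integrable lborel (\<lambda>\<xi>. norm \<xi> ^ k * norm (G \<xi>))"
  by (simp add: rapidly_decaying_def)

lemma rapidly_decaying_mult:
  fixes G :: "real ^ 'd \<Rightarrow> complex"
  assumes G: "rapidly_decaying G" and [measurable]: "m \<in> borel_measurable borel"
    and m: "\<And>\<xi>. norm (m \<xi>) \<le> c * norm \<xi> ^ l"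
  shows "rapidly_decaying (\<lambda>\<xi>. m \<xi> * G \<xi>)"
  unfolding rapidly_decaying_def
proof safe
  note [measurable] = rapidly_decaying_measurable[OF G]
  show "(\<lambda>\<xi>. m \<xi> * G \<xi>) \<in> borel_measurable borel" by measurable
  fix k
  show "integrable lborel (\<lambda>\<xi>. norm \<xi> ^ k * norm (m \<xi> * G \<xi>))"
  proof (rule Bochner_Integration.integrable_bound)
    show "integrable lborel (\<lambda>\<xi>. c * (norm \<xi> ^ (k + l) * norm (G \<xi>)))"
      by (intro integrable_mult_right rapidly_decayingD[OF G])
    have "norm \<xi> ^ k * norm (m \<xi> * G \<xi>) \<le> c * (norm \<xi> ^ (k + l) * norm (G \<xi>))" for \<xi>
      using mult_left_mono[OF mult_right_mono[OF m[of \<xi>] norm_ge_zero[of "G \<xi>"]], of "norm \<xi> ^ k"]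
      by (simp add: norm_mult power_add algebra_simps)
    then show "AE \<xi> in lborel. norm (norm \<xi> ^ k * norm (m \<xi> * G \<xi>)) \<le> norm (c * (norm \<xi> ^ (k + l) * norm (G \<xi>)))"
      by (intro AE_I2) (auto intro: order.trans[OF _ abs_ge_self])
  qed auto
qed

lemma integrable_fourier_synthesis:
  assumes G: "rapidly_decaying G"
  shows "integrable lborel (\<lambda>\<xi>. exp (\<i> * complex_of_real (x \<bullet> \<xi>)) * G \<xi>)"
proof -
  note [measurable] = rapidly_decaying_measurable[OF G]
  show ?thesis
    by (rule Bochner_Integration.integrable_bound[OF rapidly_decayingD[OF G, of 0]]) (auto simp: norm_mult)
qed

lemma norm_iexp_minus_1_le: "norm (exp (\<i> * complex_of_real x) - 1) \<le> \<bar>x\<bar>"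
  using iexp_approx1[of x 0] by simp

lemma norm_iexp_minus_linear_le: "norm (exp (\<i> * complex_of_real x) - 1 - \<i> * complex_of_real x) \<le> x\<^sup>2"
proof -
  have "norm (exp (\<i> * complex_of_real x) - 1 - \<i> * complex_of_real x) \<le> x\<^sup>2 / 2"
    using iexp_approx1[of x 1] by (simp add: algebra_simps power2_eq_square)
  then show ?thesis using zero_le_power2[of x] by linarith
qed

text \<open>A quadratic remainder for all increments makes the difference quotient converge at a linear rate.
  Together with \<open>|exp (ix) - 1 - ix| \<le> x\<^sup>2\<close> it turns differentiation under the integral into a bound by the
  second moment of the spectrum.\<close>

lemma has_vector_derivative_of_quadratic_remainder:
  fixes f :: "real \<Rightarrow> 'a::real_normed_vector"
  assumes "\<And>s. norm (f s - f 0 - s *\<^sub>R D) \<le> B * s\<^sup>2"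
  shows "(f has_vector_derivative D) (at 0)"
  unfolding has_vector_derivative_def has_derivative_iff_norm
proof
  show "bounded_linear (\<lambda>x. x *\<^sub>R D)" by (rule bounded_linear_scaleR_left)
  show "((\<lambda>y. norm (f y - f 0 - (y - 0) *\<^sub>R D) / norm (y - 0)) \<longlongrightarrow> 0) (at 0)"
  proof (rule Lim_null_comparison)
    show "\<forall>\<^sub>F y in at 0. norm (norm (f y - f 0 - (y - 0) *\<^sub>R D) / norm (y - 0)) \<le> B * \<bar>y\<bar>"
      unfolding eventually_at
      by (rule exI[of _ 1]) (use assms in \<open>auto simp: divide_simps power2_eq_square mult.assoc\<close>)
    show "((\<lambda>y. B * \<bar>y\<bar>) \<longlongrightarrow> 0) (at 0)"
      by (auto intro!: tendsto_eq_intros)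
  qed
qed

text \<open>The synthesis is Lipschitz, the first moment of the spectrum being a Lipschitz constant.\<close>

lemma continuous_fourier_synthesis:
  assumes G: "rapidly_decaying G"
  shows "continuous_on UNIV (fourier_synthesis G)"
proof -
  note [measurable] = rapidly_decaying_measurable[OF G]
  define L where "L = (\<integral>\<xi>. norm \<xi> ^ 1 * norm (G \<xi>) \<partial>lborel)"
  have L: "L \<ge> 0" unfolding L_def by (rule Bochner_Integration.integral_nonneg) simp
  have lip: "norm (fourier_synthesis G x - fourier_synthesis G y) \<le> L * norm (x - y)" for x y
  proof -
    have "fourier_synthesis G x - fourier_synthesis G y
        = (\<integral>\<xi>. exp (\<i> * complex_of_real (x \<bullet> \<xi>)) * G \<xi> - exp (\<i> * complex_of_real (y \<bullet> \<xi>)) * G \<xi> \<partial>lborel)"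
      unfolding fourier_synthesis_def
      by (rule Bochner_Integration.integral_diff[symmetric]) (rule integrable_fourier_synthesis[OF G])+
    also have "norm \<dots> \<le> (\<integral>\<xi>. norm (x - y) * (norm \<xi> ^ 1 * norm (G \<xi>)) \<partial>lborel)"
    proof (rule Bochner_Integration.integral_norm_bound_integral)
      show "integrable lborel (\<lambda>\<xi>. norm (x - y) * (norm \<xi> ^ 1 * norm (G \<xi>)))"
        by (intro integrable_mult_right rapidly_decayingD[OF G])
      fix \<xi>
      have "exp (\<i> * complex_of_real (x \<bullet> \<xi>)) - exp (\<i> * complex_of_real (y \<bullet> \<xi>))
         = exp (\<i> * complex_of_real (y \<bullet> \<xi>)) * (exp (\<i> * complex_of_real ((x - y) \<bullet> \<xi>)) - 1)"
        by (simp add: exp_add[symmetric] algebra_simps inner_diff_left)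
      then have "norm (exp (\<i> * complex_of_real (x \<bullet> \<xi>)) - exp (\<i> * complex_of_real (y \<bullet> \<xi>))) \<le> \<bar>(x - y) \<bullet> \<xi>\<bar>"
        using norm_iexp_minus_1_le[of "(x - y) \<bullet> \<xi>"] by (simp add: norm_mult)
      also have "\<dots> \<le> norm (x - y) * norm \<xi>" by (rule Cauchy_Schwarz_ineq2)
      finally show "norm (exp (\<i> * complex_of_real (x \<bullet> \<xi>)) * G \<xi> - exp (\<i> * complex_of_real (y \<bullet> \<xi>)) * G \<xi>)
         \<le> norm (x - y) * (norm \<xi> ^ 1 * norm (G \<xi>))"
        by (simp add: norm_mult left_diff_distrib[symmetric] mult.assoc[symmetric] mult_right_mono)
    qed (auto intro: integrable_fourier_synthesis[OF G])
    also have "\<dots> = L * norm (x - y)" by (simp add: L_def)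
    finally show ?thesis .
  qed
  show ?thesis
    by (rule lipschitz_on_continuous_on[of L]) (use lip L in \<open>auto intro!: lipschitz_onI simp: dist_norm\<close>)
qed

text \<open>Integrating the second-order Taylor remainder of \<open>s \<mapsto> exp (i s \<xi>\<^sub>j)\<close> against \<open>|G|\<close> costs
  \<open>s\<^sup>2 |\<xi>|\<^sup>2\<close>, and the second moment of \<open>G\<close> is finite.\<close>

lemma fourier_synthesis_has_partial_derivative:
  fixes G :: "real ^ 'd \<Rightarrow> complex"
  assumes G: "rapidly_decaying G"
  shows "((\<lambda>s. fourier_synthesis G (x + s *\<^sub>R axis j 1)) has_vector_derivative
           fourier_synthesis (\<lambda>\<xi>. \<i> * complex_of_real (\<xi> $ j) * G \<xi>) x) (at 0)"
    (is "(?f has_vector_derivative ?D) _")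
proof (rule has_vector_derivative_of_quadratic_remainder)
  fix s :: real
  note [measurable] = rapidly_decaying_measurable[OF G]
  let ?e = "\<lambda>\<xi>. exp (\<i> * complex_of_real (x \<bullet> \<xi>))"
  have G': "rapidly_decaying (\<lambda>\<xi>. \<i> * complex_of_real (\<xi> $ j) * G \<xi>)"
    by (rule rapidly_decaying_mult[OF G, of _ 1 1]) (auto simp: norm_mult component_le_norm_cart)
  note int = integrable_fourier_synthesis[OF G] integrable_fourier_synthesis[OF G']
  have "?f s - ?f 0 - s *\<^sub>R ?D = (\<integral>\<xi>. exp (\<i> * complex_of_real ((x + s *\<^sub>R axis j 1) \<bullet> \<xi>)) * G \<xi>
       - ?e \<xi> * G \<xi> - s *\<^sub>R (?e \<xi> * (\<i> * complex_of_real (\<xi> $ j) * G \<xi>)) \<partial>lborel)"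
    unfolding fourier_synthesis_def using int
    by (simp add: Bochner_Integration.integral_diff del: integral_mult_right integral_mult_left scaleR_conv_of_real)
  also have "norm \<dots> \<le> (\<integral>\<xi>. s\<^sup>2 * (norm \<xi> ^ 2 * norm (G \<xi>)) \<partial>lborel)"
  proof (rule Bochner_Integration.integral_norm_bound_integral)
    show "integrable lborel (\<lambda>\<xi>. s\<^sup>2 * (norm \<xi> ^ 2 * norm (G \<xi>)))"
      by (intro integrable_mult_right rapidly_decayingD[OF G])
    show "integrable lborel (\<lambda>\<xi>. exp (\<i> * complex_of_real ((x + s *\<^sub>R axis j 1) \<bullet> \<xi>)) * G \<xi>
       - ?e \<xi> * G \<xi> - s *\<^sub>R (?e \<xi> * (\<i> * complex_of_real (\<xi> $ j) * G \<xi>)))"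
      by (intro Bochner_Integration.integrable_diff integrable_scaleR_right int)
    fix \<xi>
    have ip: "(x + s *\<^sub>R axis j 1) \<bullet> \<xi> = x \<bullet> \<xi> + s * \<xi> $ j"
      by (simp add: inner_add_left inner_axis')
    have "exp (\<i> * complex_of_real ((x + s *\<^sub>R axis j 1) \<bullet> \<xi>)) * G \<xi>
       - ?e \<xi> * G \<xi> - s *\<^sub>R (?e \<xi> * (\<i> * complex_of_real (\<xi> $ j) * G \<xi>))
      = ?e \<xi> * (exp (\<i> * complex_of_real (s * \<xi> $ j)) - 1 - \<i> * complex_of_real (s * \<xi> $ j)) * G \<xi>"
      unfolding ip by (simp add: exp_add algebra_simps scaleR_conv_of_real)
    also have "norm \<dots> \<le> (s * \<xi> $ j)\<^sup>2 * norm (G \<xi>)"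
      using norm_iexp_minus_linear_le[of "s * \<xi> $ j"] by (simp add: norm_mult mult_right_mono)
    also have "\<dots> \<le> s\<^sup>2 * ((norm \<xi>)\<^sup>2 * norm (G \<xi>))"
      using component_le_norm_cart[of \<xi> j]
      by (auto simp: power_mult_distrib mult.assoc intro!: mult_left_mono mult_right_mono power2_le_iff_abs_le[THEN iffD2])
    finally show "norm (exp (\<i> * complex_of_real ((x + s *\<^sub>R axis j 1) \<bullet> \<xi>)) * G \<xi>
       - ?e \<xi> * G \<xi> - s *\<^sub>R (?e \<xi> * (\<i> * complex_of_real (\<xi> $ j) * G \<xi>))) \<le> s\<^sup>2 * (norm \<xi> ^ 2 * norm (G \<xi>))" .
  qed
  finally show "norm (?f s - ?f 0 - s *\<^sub>R ?D) \<le> (\<integral>\<xi>. norm \<xi> ^ 2 * norm (G \<xi>) \<partial>lborel) * s\<^sup>2"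
    by (simp add: mult.commute)
qed

definition derivative_symbol :: "'d list \<Rightarrow> real ^ 'd \<Rightarrow> complex" where
  "derivative_symbol js \<xi> = (\<Prod>j\<leftarrow>js. \<i> * complex_of_real (\<xi> $ j))"

lemma derivative_symbol_eq_prod:
  "derivative_symbol js \<xi> = (\<Prod>j\<in>UNIV. (\<i> * complex_of_real (\<xi> $ j)) ^ count_list js j)"
proof (induction js)
  case (Cons i js)
  have "(\<Prod>j\<in>UNIV. (\<i> * complex_of_real (\<xi> $ j)) ^ count_list (i # js) j)
      = (\<Prod>j\<in>UNIV. (if j = i then \<i> * complex_of_real (\<xi> $ j) else 1) * (\<i> * complex_of_real (\<xi> $ j)) ^ count_list js j)"
    by (intro prod.cong) auto
  then show ?case using Cons by (simp add: prod.distrib derivative_symbol_def)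
qed (simp add: derivative_symbol_def)

lemma derivative_symbol_measurable [measurable]: "derivative_symbol js \<in> borel_measurable borel"
proof (induction js)
  case (Cons i js)
  have "derivative_symbol (i # js) = (\<lambda>\<xi>. \<i> * complex_of_real (\<xi> $ i) * derivative_symbol js \<xi>)"
    by (auto simp: derivative_symbol_def)
  then show ?case using Cons by simp
qed (simp add: derivative_symbol_def[abs_def])

lemma norm_derivative_symbol_le: "norm (derivative_symbol js \<xi>) \<le> norm \<xi> ^ length js"
proof (induction js)
  case (Cons i js)
  then show ?case
    by (auto simp: derivative_symbol_def norm_mult component_le_norm_cart intro!: mult_mono)
qed (simp add: derivative_symbol_def)

lemma rapidly_decaying_symbol:
  "rapidly_decaying G \<Longrightarrow> rapidly_decaying (\<lambda>\<xi>. derivative_symbol js \<xi> * G \<xi>)"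
  by (rule rapidly_decaying_mult[of _ _ 1 "length js"]) (auto simp: norm_derivative_symbol_le)

lemma iter_partial_fourier_synthesis:
  assumes G: "rapidly_decaying G"
  shows "iter_partial js (fourier_synthesis G) = fourier_synthesis (\<lambda>\<xi>. derivative_symbol js \<xi> * G \<xi>)"
proof (induction js)
  case (Cons j js)
  have "partial_deriv j (fourier_synthesis (\<lambda>\<xi>. derivative_symbol js \<xi> * G \<xi>)) x
      = fourier_synthesis (\<lambda>\<xi>. derivative_symbol (j # js) \<xi> * G \<xi>) x" for x
    unfolding partial_deriv_def
    using vector_derivative_at[OF fourier_synthesis_has_partial_derivative[OF rapidly_decaying_symbol[OF G], of js x j]]
    by (simp add: derivative_symbol_def mult.assoc)
  then show ?case using Cons by auto
qed (simp add: derivative_symbol_def)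

lemma smooth_fourier_synthesis:
  assumes G: "rapidly_decaying G"
  shows "smooth (fourier_synthesis G)"
  unfolding smooth_def iter_partial_fourier_synthesis[OF G]
  using continuous_fourier_synthesis[OF rapidly_decaying_symbol[OF G]]
    fourier_synthesis_has_partial_derivative[OF rapidly_decaying_symbol[OF G]]
  by (blast intro: differentiableI_vector)

text \<open>The symbol depends only on how often each index occurs, so the
  arbitrary order of differentiation chosen in \<open>multi_deriv\<close> does not matter.\<close>

lemma multi_deriv_fourier_synthesis:
  fixes G :: "real ^ 'd \<Rightarrow> complex"
  assumes G: "rapidly_decaying G"
  obtains js where "length js = multi_order \<sigma>"
    "\<And>\<xi>. derivative_symbol js \<xi> = (\<Prod>j\<in>UNIV. (\<i> * complex_of_real (\<xi> $ j)) ^ \<sigma> j)"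
    "multi_deriv \<sigma> (fourier_synthesis G) = fourier_synthesis (\<lambda>\<xi>. derivative_symbol js \<xi> * G \<xi>)"
proof -
  define js where "js = (SOME js. \<forall>i. count_list js i = \<sigma> i)"
  have js: "\<forall>i. count_list js i = \<sigma> i"
    unfolding js_def by (rule someI_ex) (rule multi_index_list_exists)
  have "length js = (\<Sum>i\<in>set js. count_list js i)" by (rule sum_count_set[symmetric]) auto
  also have "\<dots> = (\<Sum>i\<in>UNIV. count_list js i)"
    by (rule sum.mono_neutral_left) (auto simp: count_list_0_iff)
  finally have "length js = multi_order \<sigma>" using js by (simp add: multi_order_def)
  then show ?thesis
    by (rule that)
       (simp_all add: derivative_symbol_eq_prod js multi_deriv_def flip: js_def,
        simp add: iter_partial_fourier_synthesis[OF G] derivative_symbol_eq_prod js)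
qed

section \<open>The heat flow on the Fourier side and the upper bound\<close>

lemma rapidly_decaying_heat_multiplier:
  assumes "0 < t" "0 < p"
  shows "rapidly_decaying (\<lambda>\<xi>::real ^ 'd. complex_of_real (exp (- t * norm \<xi> powr p)))"
  unfolding rapidly_decaying_def using integrable_norm_pow_mult_exp[OF assms] by auto

lemma prob_momentD:
  assumes "\<mu> \<in> prob_moment \<alpha>"
  shows "prob_space \<mu>" "sets \<mu> = sets borel"
  using assms by (auto simp: prob_moment_def)

lemma fourier_measurable [measurable]:
  fixes \<mu> :: "(real ^ 'd) measure"
  assumes "prob_space \<mu>" and [measurable_cong]: "sets \<mu> = sets borel"
  shows "fourier \<mu> \<in> borel_measurable borel"
proof -
  interpret prob_space \<mu> by fact
  show ?thesis unfolding fourier_def[abs_def] by measurable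
qed

lemma norm_fourier_le:
  assumes "prob_space \<mu>"
  shows "norm (fourier \<mu> \<xi>) \<le> 1"
proof -
  interpret prob_space \<mu> by fact
  have "norm (fourier \<mu> \<xi>) \<le> (\<integral>v. norm (exp (- (\<i> * complex_of_real (\<xi> \<bullet> v)))) \<partial>\<mu>)"
    unfolding fourier_def by (rule integral_norm_bound)
  then show ?thesis by (simp add: prob_space)
qed

text \<open>The parabolic scaling of the kernel is the substitution \<open>\<xi> \<mapsto> t\<^sup>-\<^sup>1\<^sup>/\<^sup>p \<xi>\<close> in its defining integral.\<close>

lemma heat_kernel_eq_fourier_synthesis:
  fixes z :: "real ^ 'd"
  assumes "0 < t" "0 < p"
  shows "heat_kernel p z t = complex_of_real ((2 * pi) powr (- real CARD('d))) *
     fourier_synthesis (\<lambda>\<xi>. complex_of_real (exp (- t * norm \<xi> powr p))) z"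
proof -
  define c where "c = t powr (- 1 / p)"
  have c: "c > 0" using assms by (simp add: c_def)
  have cp: "c powr p = 1 / t"
    using assms unfolding c_def powr_powr by (simp add: powr_minus_divide)
  have cd: "c ^ CARD('d) = t powr (- real CARD('d) / p)"
    using c by (simp add: c_def powr_realpow[symmetric] powr_powr)
  have e: "exp (\<i> * complex_of_real (z \<bullet> (0 + c *\<^sub>R \<xi>))) * complex_of_real (exp (- t * norm (0 + c *\<^sub>R \<xi>) powr p))
     = exp (\<i> * complex_of_real ((c *\<^sub>R z) \<bullet> \<xi>) - complex_of_real (norm \<xi> powr p))" for \<xi> :: "real ^ 'd"
    using assms c cp by (simp add: powr_mult exp_diff exp_of_real exp_minus field_simps)
  have "fourier_synthesis (\<lambda>\<xi>. complex_of_real (exp (- t * norm \<xi> powr p))) z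
      = c ^ CARD('d) *\<^sub>R (\<integral>\<xi>. exp (\<i> * complex_of_real ((c *\<^sub>R z) \<bullet> \<xi>) - complex_of_real (norm \<xi> powr p)) \<partial>lborel)"
    unfolding fourier_synthesis_def e[symmetric]
    using c by (subst lborel_integral_affine[of _ c 0]) auto
  then show ?thesis
    unfolding heat_kernel_def heat_profile_def cd c_def[symmetric]
    by (simp add: scaleR_conv_of_real)
qed

text \<open>Fubini: the double integral over \<open>y\<close> and \<open>\<xi>\<close> converges absolutely because \<open>\<mu>\<close> is finite and
  the multiplier is integrable; the inner integral over \<open>y\<close> is the Fourier transform of \<open>\<mu>\<close>.\<close>

lemma heat_solution_eq_fourier_synthesis:
  fixes \<mu> :: "(real ^ 'd) measure"
  assumes "0 < t" "0 < p" "prob_space \<mu>" and [measurable_cong]: "sets \<mu> = sets borel"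
  shows "heat_solution p \<mu> x t = complex_of_real ((2 * pi) powr (- real CARD('d))) *
     fourier_synthesis (\<lambda>\<xi>. complex_of_real (exp (- t * norm \<xi> powr p)) * fourier \<mu> \<xi>) x"
proof -
  interpret prob_space \<mu> by fact
  interpret P: pair_sigma_finite \<mu> "lborel :: (real ^ 'd) measure" by standard
  let ?H = "\<lambda>\<xi>::real ^ 'd. complex_of_real (exp (- t * norm \<xi> powr p))"
  let ?f = "\<lambda>y \<xi>. exp (\<i> * complex_of_real ((x - y) \<bullet> \<xi>)) * ?H \<xi>"
  have H: "rapidly_decaying ?H" using assms by (intro rapidly_decaying_heat_multiplier)
  have int: "integrable (\<mu> \<Otimes>\<^sub>M lborel) (\<lambda>(y, \<xi>). ?f y \<xi>)"
  proof (rule P.Fubini_integrable)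
    show "(\<lambda>(y, \<xi>). ?f y \<xi>) \<in> borel_measurable (\<mu> \<Otimes>\<^sub>M lborel)" by measurable
    show "integrable \<mu> (\<lambda>y. \<integral>\<xi>. norm (case (y, \<xi>) of (y, \<xi>) \<Rightarrow> ?f y \<xi>) \<partial>lborel)"
      by (simp add: norm_mult)
    show "AE y in \<mu>. integrable lborel (\<lambda>\<xi>. case (y, \<xi>) of (y, \<xi>) \<Rightarrow> ?f y \<xi>)"
      using integrable_fourier_synthesis[OF H] by simp
  qed
  have "(\<integral>y. fourier_synthesis ?H (x - y) \<partial>\<mu>) = (\<integral>y. \<integral>\<xi>. ?f y \<xi> \<partial>lborel \<partial>\<mu>)"
    by (simp add: fourier_synthesis_def)
  also have "\<dots> = (\<integral>\<xi>. \<integral>y. ?f y \<xi> \<partial>\<mu> \<partial>lborel)"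
    by (rule P.Fubini_integral[OF int, symmetric])
  also have "\<dots> = fourier_synthesis (\<lambda>\<xi>. ?H \<xi> * fourier \<mu> \<xi>) x"
    unfolding fourier_synthesis_def
  proof (rule Bochner_Integration.integral_cong[OF refl])
    fix \<xi>
    have "?f y \<xi> = exp (\<i> * complex_of_real (x \<bullet> \<xi>)) * ?H \<xi> * exp (- (\<i> * complex_of_real (\<xi> \<bullet> y)))" for y
      by (simp add: inner_diff_left inner_commute[of \<xi>] exp_minus exp_diff algebra_simps divide_inverse)
    then show "(\<integral>y. ?f y \<xi> \<partial>\<mu>) = exp (\<i> * complex_of_real (x \<bullet> \<xi>)) * (?H \<xi> * fourier \<mu> \<xi>)"
      by (simp add: fourier_def mult.assoc)
  qed
  finally show ?thesis
    unfolding heat_solution_def heat_kernel_eq_fourier_synthesis[OF assms(1,2)] by simp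
qed

text \<open>The normalising factor \<open>(2\<pi>)\<^sup>-\<^sup>d\<close> is included, so that the difference of the solutions is
  exactly the synthesis of this function.\<close>

definition heat_spectrum :: "real \<Rightarrow> real \<Rightarrow> (real ^ 'd) measure \<Rightarrow> (real ^ 'd) measure \<Rightarrow> real ^ 'd \<Rightarrow> complex" where
  "heat_spectrum p t \<mu> \<nu> \<xi> = complex_of_real ((2 * pi) powr (- real CARD('d)) * exp (- t * norm \<xi> powr p)) *
     (fourier \<mu> \<xi> - fourier \<nu> \<xi>)"

lemma
  fixes \<mu> \<nu> :: "(real ^ 'd) measure"
  assumes "0 < t" "0 < p" "\<mu> \<in> prob_moment \<alpha>" "\<nu> \<in> prob_moment \<alpha>"
  shows rapidly_decaying_heat_spectrum: "rapidly_decaying (heat_spectrum p t \<mu> \<nu>)"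
    and heat_difference_eq_fourier_synthesis:
      "(\<lambda>x. heat_solution p \<mu> x t - heat_solution p \<nu> x t) = fourier_synthesis (heat_spectrum p t \<mu> \<nu>)"
proof -
  note \<mu> = prob_momentD[OF assms(3)] and \<nu> = prob_momentD[OF assms(4)]
  note [measurable] = fourier_measurable[OF \<mu>] fourier_measurable[OF \<nu>]
  let ?K = "(2 * pi) powr (- real CARD('d))"
  let ?H = "\<lambda>\<xi>::real ^ 'd. complex_of_real (exp (- t * norm \<xi> powr p))"
  have H: "rapidly_decaying ?H" using assms by (intro rapidly_decaying_heat_multiplier)
  have mu: "rapidly_decaying (\<lambda>\<xi>. fourier \<mu> \<xi> * ?H \<xi>)"
    by (rule rapidly_decaying_mult[OF H, of _ 1 0]) (auto simp: norm_fourier_le[OF \<mu>(1)])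
  have nu: "rapidly_decaying (\<lambda>\<xi>. fourier \<nu> \<xi> * ?H \<xi>)"
    by (rule rapidly_decaying_mult[OF H, of _ 1 0]) (auto simp: norm_fourier_le[OF \<nu>(1)])
  have D: "norm (fourier \<mu> \<xi> - fourier \<nu> \<xi>) \<le> 2" for \<xi>
    using norm_triangle_ineq4[of "fourier \<mu> \<xi>" "fourier \<nu> \<xi>"] norm_fourier_le[OF \<mu>(1), of \<xi>] norm_fourier_le[OF \<nu>(1), of \<xi>]
    by linarith
  have eq: "heat_spectrum p t \<mu> \<nu> = (\<lambda>\<xi>. complex_of_real ?K * (fourier \<mu> \<xi> - fourier \<nu> \<xi>) * ?H \<xi>)"
    by (auto simp: heat_spectrum_def)
  show "rapidly_decaying (heat_spectrum p t \<mu> \<nu>)"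
    unfolding eq
    by (rule rapidly_decaying_mult[OF H, of _ "?K * 2" 0]) (auto simp: norm_mult intro!: mult_left_mono D)
  show "(\<lambda>x. heat_solution p \<mu> x t - heat_solution p \<nu> x t) = fourier_synthesis (heat_spectrum p t \<mu> \<nu>)"
  proof
    fix x
    have "heat_solution p \<mu> x t - heat_solution p \<nu> x t
        = complex_of_real ?K * (fourier_synthesis (\<lambda>\<xi>. fourier \<mu> \<xi> * ?H \<xi>) x - fourier_synthesis (\<lambda>\<xi>. fourier \<nu> \<xi> * ?H \<xi>) x)"
      by (simp add: heat_solution_eq_fourier_synthesis[OF assms(1,2)] \<mu> \<nu> right_diff_distrib mult.commute)
    also have "\<dots> = complex_of_real ?K * (\<integral>\<xi>. exp (\<i> * complex_of_real (x \<bullet> \<xi>)) * (fourier \<mu> \<xi> * ?H \<xi>)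
         - exp (\<i> * complex_of_real (x \<bullet> \<xi>)) * (fourier \<nu> \<xi> * ?H \<xi>) \<partial>lborel)"
      unfolding fourier_synthesis_def
      using integrable_fourier_synthesis[OF mu] integrable_fourier_synthesis[OF nu]
      by (subst Bochner_Integration.integral_diff) auto
    also have "\<dots> = fourier_synthesis (heat_spectrum p t \<mu> \<nu>) x"
      unfolding fourier_synthesis_def eq integral_mult_right_zero[symmetric]
      by (intro Bochner_Integration.integral_cong) (auto simp: algebra_simps)
    finally show "heat_solution p \<mu> x t - heat_solution p \<nu> x t = fourier_synthesis (heat_spectrum p t \<mu> \<nu>) x" .
  qed
qed

lemma A_const_pos:
  assumes "0 < p" "0 < \<alpha>"
  shows "0 < A_const p \<alpha> \<sigma>"
  using assms unfolding A_const_def by (intro mult_pos_pos) (auto intro!: divide_pos_pos add_pos_nonneg simp: less_eq_real_def)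

text \<open>Take absolute values in the synthesis integral, split off the weight \<open>|\<xi>|\<^sup>-\<^sup>d\<^sup>-\<^sup>\<alpha>\<close> of \<open>\<rho>\<^sub>\<alpha>\<close>, and bound the remaining
  factor \<open>|\<xi>|\<^sup>a exp (- t |\<xi>|\<^sup>p)\<close> by its maximum. If \<open>\<rho>\<^sub>\<alpha>\<close> is infinite the argument still runs, since it
  takes place in the extended nonnegative reals.\<close>

lemma sup_norm_multi_deriv_le:
  fixes \<mu> \<nu> :: "(real ^ 'd) measure"
  assumes p: "0 < p" and \<alpha>: "0 < \<alpha>" and t: "0 < t" and \<mu>: "\<mu> \<in> prob_moment \<alpha>" and \<nu>: "\<nu> \<in> prob_moment \<alpha>"
  shows "sup_norm (multi_deriv \<sigma> (\<lambda>x. heat_solution p \<mu> x t - heat_solution p \<nu> x t))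
         \<le> ennreal (A_const p \<alpha> \<sigma> * t powr (- (\<alpha> + real CARD('d) + real (multi_order \<sigma>)) / p)) * rho \<alpha> \<mu> \<nu>"
proof -
  let ?K = "(2 * pi) powr (- real CARD('d))"
  let ?D = "\<lambda>\<xi>. fourier \<mu> \<xi> - fourier \<nu> \<xi>"
  define a where "a = \<alpha> + real CARD('d) + real (multi_order \<sigma>)"
  define B where "B = A_const p \<alpha> \<sigma> * t powr (- a / p)"
  have a: "0 < a" using \<alpha> by (simp add: a_def add_pos_nonneg)
  have B0: "0 \<le> B" using A_const_pos[OF p \<alpha>, of \<sigma>] by (simp add: B_def)
  have B: "B = ?K * (a / (exp 1 * p * t)) powr (a / p)"
  proof -
    have "t powr (- a / p) = (1 / t) powr (a / p)" using t by (simp add: powr_minus powr_divide inverse_eq_divide)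
    then have "(a / (exp 1 * p)) powr (a / p) * t powr (- a / p) = (a / (exp 1 * p) * (1 / t)) powr (a / p)"
      using a p t by (subst powr_mult) auto
    then show ?thesis by (simp add: B_def A_const_def a_def mult.assoc)
  qed
  note [measurable] = fourier_measurable[OF prob_momentD[OF \<mu>]] fourier_measurable[OF prob_momentD[OF \<nu>]]
  have G: "rapidly_decaying (heat_spectrum p t \<mu> \<nu>)"
    by (rule rapidly_decaying_heat_spectrum[OF t p \<mu> \<nu>])
  note [measurable] = rapidly_decaying_measurable[OF G]
  obtain js where js: "length js = multi_order \<sigma>"
      "multi_deriv \<sigma> (fourier_synthesis (heat_spectrum p t \<mu> \<nu>)) = fourier_synthesis (\<lambda>\<xi>. derivative_symbol js \<xi> * heat_spectrum p t \<mu> \<nu> \<xi>)"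
    using multi_deriv_fourier_synthesis[OF G] by blast
  have ptw: "norm (derivative_symbol js \<xi> * heat_spectrum p t \<mu> \<nu> \<xi>)
      \<le> B * (norm (?D \<xi>) / norm \<xi> powr (real CARD('d) + \<alpha>))" if "\<xi> \<noteq> 0" for \<xi>
  proof -
    let ?r = "norm \<xi>"
    have r: "?r > 0" using that by simp
    have "norm (derivative_symbol js \<xi> * heat_spectrum p t \<mu> \<nu> \<xi>)
        \<le> ?r ^ length js * (?K * exp (- t * ?r powr p) * norm (?D \<xi>))"
      unfolding norm_mult heat_spectrum_def
      by (intro mult_mono norm_derivative_symbol_le) (auto simp: norm_mult)
    also have "?r ^ length js = ?r powr a / ?r powr (real CARD('d) + \<alpha>)"
      using r by (simp add: a_def js powr_diff[symmetric] powr_realpow[symmetric])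
    also have "?r powr a / ?r powr (real CARD('d) + \<alpha>) * (?K * exp (- t * ?r powr p) * norm (?D \<xi>))
       = ?K * (?r powr a * exp (- t * ?r powr p)) * (norm (?D \<xi>) / ?r powr (real CARD('d) + \<alpha>))"
      by simp
    also have "\<dots> \<le> B * (norm (?D \<xi>) / ?r powr (real CARD('d) + \<alpha>))"
      unfolding B using powr_mult_exp_le[of ?r a t p] a p t
      by (intro mult_right_mono mult_left_mono) auto
    finally show ?thesis .
  qed
  have "sup_norm (fourier_synthesis (\<lambda>\<xi>. derivative_symbol js \<xi> * heat_spectrum p t \<mu> \<nu> \<xi>)) \<le> ennreal B * rho \<alpha> \<mu> \<nu>"
    unfolding sup_norm_def
  proof (rule SUP_least)
    fix x
    let ?g = "\<lambda>\<xi>. exp (\<i> * complex_of_real (x \<bullet> \<xi>)) * (derivative_symbol js \<xi> * heat_spectrum p t \<mu> \<nu> \<xi>)"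
    have "ennreal (norm (fourier_synthesis (\<lambda>\<xi>. derivative_symbol js \<xi> * heat_spectrum p t \<mu> \<nu> \<xi>) x))
       \<le> (\<integral>\<^sup>+\<xi>. ennreal (norm (?g \<xi>)) \<partial>lborel)"
      unfolding fourier_synthesis_def
      by (rule integral_norm_bound_ennreal[OF integrable_fourier_synthesis[OF rapidly_decaying_symbol[OF G]]])
    also have "\<dots> \<le> (\<integral>\<^sup>+\<xi>. ennreal B * ennreal (norm (?D \<xi>) / norm \<xi> powr (real CARD('d) + \<alpha>)) \<partial>lborel)"
    proof (rule nn_integral_mono_AE)
      show "AE \<xi> in lborel. ennreal (norm (?g \<xi>)) \<le> ennreal B * ennreal (norm (?D \<xi>) / norm \<xi> powr (real CARD('d) + \<alpha>))"
        using AE_lborel_singleton[of "0::real ^ 'd"]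
      proof eventually_elim
        case (elim \<xi>)
        have "norm (?g \<xi>) = norm (derivative_symbol js \<xi> * heat_spectrum p t \<mu> \<nu> \<xi>)"
          by (simp add: norm_mult)
        with ptw[OF elim] show ?case
          using B0 by (simp add: ennreal_mult[symmetric] ennreal_leI)
      qed
    qed
    also have "\<dots> = ennreal B * rho \<alpha> \<mu> \<nu>"
      unfolding rho_def by (rule nn_integral_cmult) measurable
    finally show "ennreal (norm (fourier_synthesis (\<lambda>\<xi>. derivative_symbol js \<xi> * heat_spectrum p t \<mu> \<nu> \<xi>) x))
       \<le> ennreal B * rho \<alpha> \<mu> \<nu>" .
  qed
  then show ?thesis
    unfolding heat_difference_eq_fourier_synthesis[OF t p \<mu> \<nu>] js(2) by (simp add: B_def a_def)
qed

section \<open>Real densities as differences of probability measures\<close>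

text \<open>The first moment bounds all moments of order \<open>\<alpha> \<le> 1\<close>, and unlike them it is handled by
  polynomial weights alone.\<close>

definition has_first_moment :: "(real ^ 'd \<Rightarrow> real) \<Rightarrow> bool" where
  "has_first_moment \<phi> \<longleftrightarrow> integrable lborel \<phi> \<and> integrable lborel (\<lambda>v. norm v * \<phi> v)"

definition density_fourier :: "(real ^ 'd \<Rightarrow> real) \<Rightarrow> real ^ 'd \<Rightarrow> complex" where
  "density_fourier \<phi> \<xi> = (\<integral>v. exp (- (\<i> * complex_of_real (\<xi> \<bullet> v))) * complex_of_real (\<phi> v) \<partial>lborel)"

lemma has_first_moment_measurable [measurable_dest]:
  "has_first_moment \<phi> \<Longrightarrow> \<phi> \<in> borel_measurable borel"
  by (auto simp: has_first_moment_def dest: borel_measurable_integrable)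

lemma has_first_moment_add:
  "has_first_moment \<phi> \<Longrightarrow> has_first_moment \<psi> \<Longrightarrow> has_first_moment (\<lambda>v. \<phi> v + \<psi> v)"
  by (simp add: has_first_moment_def distrib_left)

lemma has_first_moment_cmult:
  assumes "has_first_moment \<phi>"
  shows "has_first_moment (\<lambda>v. c * \<phi> v)"
proof -
  have "integrable lborel (\<lambda>v. c * (norm v * \<phi> v))"
    using assms by (simp add: has_first_moment_def)
  then show ?thesis
    using assms by (simp add: has_first_moment_def mult.left_commute)
qed

lemma integrable_density_fourier:
  assumes "has_first_moment \<phi>"
  shows "integrable lborel (\<lambda>v. exp (- (\<i> * complex_of_real (\<xi> \<bullet> v))) * complex_of_real (\<phi> v))"
proof -
  note [measurable] = has_first_moment_measurable[OF assms]
  have "integrable lborel \<phi>" using assms by (simp add: has_first_moment_def)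
  then show ?thesis
    by (rule Bochner_Integration.integrable_bound) (auto simp: norm_mult)
qed

text \<open>The moment condition follows from \<open>|v|\<^sup>\<alpha> \<le> 1 + |v|\<close>.\<close>

lemma density_in_prob_moment:
  assumes h: "has_first_moment h" and nn: "\<And>v. 0 \<le> h v" and one: "(\<integral>v. h v \<partial>lborel) = 1"
    and \<alpha>: "0 < \<alpha>" "\<alpha> \<le> 1"
  shows "density lborel (\<lambda>v. ennreal (h v)) \<in> prob_moment \<alpha>"
    and "fourier (density lborel (\<lambda>v. ennreal (h v))) \<xi> = density_fourier h \<xi>"
proof -
  note [measurable] = has_first_moment_measurable[OF h]
  have int: "integrable lborel h" "integrable lborel (\<lambda>v. norm v * h v)"
    using h by (auto simp: has_first_moment_def)
  show "fourier (density lborel (\<lambda>v. ennreal (h v))) \<xi> = density_fourier h \<xi>"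
    unfolding fourier_def density_fourier_def
    by (subst integral_density) (auto simp: nn scaleR_conv_of_real mult.commute)
  have "prob_space (density lborel (\<lambda>v. ennreal (h v)))"
    by (rule prob_spaceI)
       (simp add: emeasure_density nn_integral_eq_integral[OF int(1)] nn one)
  moreover have "integrable (density lborel (\<lambda>v. ennreal (h v))) (\<lambda>v. norm v powr \<alpha>)"
  proof (subst integrable_density)
    show "integrable lborel (\<lambda>v. h v *\<^sub>R norm v powr \<alpha>)"
    proof (rule Bochner_Integration.integrable_bound)
      show "integrable lborel (\<lambda>v. h v + norm v * h v)" using int by simp
      have "norm v powr \<alpha> \<le> 1 + norm v" for v :: "real ^ 'a"
      proof (cases "norm v \<le> 1")
        case True
        then have "norm v powr \<alpha> \<le> 1" using \<alpha> by (intro powr_le1) auto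
        then show ?thesis by (simp add: add_increasing2)
      next
        case False
        then have "norm v powr \<alpha> \<le> norm v powr 1" using \<alpha> by (intro powr_mono) auto
        then show ?thesis using False by simp
      qed
      then have "h v * norm v powr \<alpha> \<le> h v + norm v * h v" for v
        using mult_left_mono[OF _ nn[of v]] by (fastforce simp: algebra_simps)
      then show "AE v in lborel. norm (h v *\<^sub>R norm v powr \<alpha>) \<le> norm (h v + norm v * h v)"
        by (simp add: nn)
    qed auto
  qed (auto simp: nn)
  ultimately show "density lborel (\<lambda>v. ennreal (h v)) \<in> prob_moment \<alpha>"
    by (simp add: prob_moment_def)
qed

text \<open>For a reference density \<open>b \<ge> |\<phi>|\<close> both \<open>b + \<phi>\<close> and \<open>b\<close> are nonnegative, and they have the same mass because
  \<open>\<phi>\<close> has mass zero. One normalisation \<open>c\<close> makes both of them probability densities, and they differ by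
  \<open>c \<phi>\<close>. The Gaussian summand in the reference density ensures that its mass is positive even if \<open>\<phi>\<close>
  vanishes.\<close>

lemma signed_density_as_difference:
  fixes \<phi> :: "real ^ 'd \<Rightarrow> real"
  assumes \<phi>: "has_first_moment \<phi>" and zero: "density_fourier \<phi> 0 = 0" and \<alpha>: "0 < \<alpha>" "\<alpha> \<le> 1"
  obtains \<mu> \<nu> c where "\<mu> \<in> prob_moment \<alpha>" "\<nu> \<in> prob_moment \<alpha>" "0 < c"
    "\<And>\<xi>. fourier \<mu> \<xi> - fourier \<nu> \<xi> = complex_of_real c * density_fourier \<phi> \<xi>"
proof -
  let ?b = "\<lambda>v. \<bar>\<phi> v\<bar> + exp (- 1 * norm v powr 2)"
  note [measurable] = has_first_moment_measurable[OF \<phi>]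
  have int: "integrable lborel \<phi>" "integrable lborel (\<lambda>v. norm v * \<phi> v)"
    using \<phi> by (auto simp: has_first_moment_def)
  have g: "integrable lborel (\<lambda>v::real ^ 'd. norm v ^ k * exp (- 1 * norm v powr 2))" for k
    by (rule integrable_norm_pow_mult_exp) auto
  have "integrable lborel (\<lambda>v. \<bar>norm v * \<phi> v\<bar>)" using int(2) by simp
  then have b: "has_first_moment ?b"
    using int g[of 0] g[of 1] by (simp add: has_first_moment_def distrib_left abs_mult)
  define c where "c = 1 / (\<integral>v. ?b v \<partial>lborel)"
  have b_int: "integrable lborel ?b" using b by (simp add: has_first_moment_def)
  have "0 < (\<integral>v. ?b v \<partial>lborel)"
    by (rule lborel_integral_pos[OF b_int]) (simp add: add_nonneg_pos)
  then have c: "0 < c" "c * (\<integral>v. ?b v \<partial>lborel) = 1" by (simp_all add: c_def)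
  have "complex_of_real (\<integral>v. \<phi> v \<partial>lborel) = 0"
    using zero by (simp add: density_fourier_def)
  then have \<phi>0: "(\<integral>v. \<phi> v \<partial>lborel) = 0" by simp
  let ?h1 = "\<lambda>v. c * (?b v + \<phi> v)" and ?h2 = "\<lambda>v. c * ?b v"
  have h1: "has_first_moment ?h1"
    by (intro has_first_moment_cmult has_first_moment_add b \<phi>)
  have h2: "has_first_moment ?h2"
    by (intro has_first_moment_cmult b)
  have nn1: "0 \<le> ?h1 v" for v
  proof -
    have "0 \<le> ?b v + \<phi> v" using abs_ge_minus_self[of "\<phi> v"] exp_ge_zero[of "- 1 * norm v powr 2"] by linarith
    then show ?thesis using c by simp
  qed
  have nn2: "0 \<le> ?h2 v" for v using c by simp
  have one1: "(\<integral>v. ?h1 v \<partial>lborel) = 1"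
    using Bochner_Integration.integral_add[OF b_int int(1)] c \<phi>0 by simp
  have one2: "(\<integral>v. ?h2 v \<partial>lborel) = 1" using c by simp
  show ?thesis
  proof (rule that[OF density_in_prob_moment(1)[OF h1 nn1 one1 \<alpha>] density_in_prob_moment(1)[OF h2 nn2 one2 \<alpha>] c(1)])
    fix \<xi>
    have "density_fourier ?h1 \<xi> - density_fourier ?h2 \<xi>
      = (\<integral>v. exp (- (\<i> * complex_of_real (\<xi> \<bullet> v))) * complex_of_real (?h1 v)
          - exp (- (\<i> * complex_of_real (\<xi> \<bullet> v))) * complex_of_real (?h2 v) \<partial>lborel)"
      unfolding density_fourier_def
      by (rule Bochner_Integration.integral_diff[symmetric]) (rule integrable_density_fourier h1 h2)+
    also have "\<dots> = complex_of_real c * density_fourier \<phi> \<xi>"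
      unfolding density_fourier_def integral_mult_right_zero[symmetric]
      by (intro Bochner_Integration.integral_cong) (auto simp: algebra_simps)
    finally show "fourier (density lborel (\<lambda>v. ennreal (?h1 v))) \<xi> - fourier (density lborel (\<lambda>v. ennreal (?h2 v))) \<xi>
       = complex_of_real c * density_fourier \<phi> \<xi>"
      unfolding density_in_prob_moment(2)[OF h1 nn1 one1 \<alpha>] density_in_prob_moment(2)[OF h2 nn2 one2 \<alpha>] .
  qed
qed

lemma
  fixes \<phi> :: "real ^ 'd \<Rightarrow> real"
  assumes \<phi>: "has_first_moment \<phi>"
  shows has_first_moment_difference: "has_first_moment (\<lambda>v. \<phi> v - \<phi> (v - a))"
    and density_fourier_difference:
      "density_fourier (\<lambda>v. \<phi> v - \<phi> (v - a)) \<xi> = (1 - exp (- (\<i> * complex_of_real (\<xi> \<bullet> a)))) * density_fourier \<phi> \<xi>"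
proof -
  note [measurable] = has_first_moment_measurable[OF \<phi>]
  have int: "integrable lborel \<phi>" "integrable lborel (\<lambda>v. norm v * \<phi> v)"
    using \<phi> by (auto simp: has_first_moment_def)
  have s1: "integrable lborel (\<lambda>v. \<phi> (v - a))"
    using lborel_integrable_affine[OF int(1), of 1 "- a"] by simp
  have s2: "integrable lborel (\<lambda>v. norm (v - a) * \<phi> (v - a))"
    using lborel_integrable_affine[OF int(2), of 1 "- a"] by simp
  have "integrable lborel (\<lambda>v. norm v * \<phi> (v - a))"
  proof (rule Bochner_Integration.integrable_bound)
    show "integrable lborel (\<lambda>v. norm (v - a) * \<bar>\<phi> (v - a)\<bar> + norm a * \<bar>\<phi> (v - a)\<bar>)"
      using s1 integrable_abs[OF s2] by (simp add: abs_mult)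
    have "norm v * \<bar>\<phi> (v - a)\<bar> \<le> norm (v - a) * \<bar>\<phi> (v - a)\<bar> + norm a * \<bar>\<phi> (v - a)\<bar>" for v
      using mult_right_mono[OF norm_triangle_ineq[of "v - a" a], of "\<bar>\<phi> (v - a)\<bar>"] by (simp add: algebra_simps)
    then show "AE v in lborel. norm (norm v * \<phi> (v - a)) \<le> norm (norm (v - a) * \<bar>\<phi> (v - a)\<bar> + norm a * \<bar>\<phi> (v - a)\<bar>)"
      by (simp add: abs_mult)
  qed auto
  then have sh: "has_first_moment (\<lambda>v. \<phi> (v - a))" using s1 by (simp add: has_first_moment_def)
  show "has_first_moment (\<lambda>v. \<phi> v - \<phi> (v - a))"
    using \<phi> sh by (simp add: has_first_moment_def right_diff_distrib)
  have "density_fourier (\<lambda>v. \<phi> (v - a)) \<xi> = exp (- (\<i> * complex_of_real (\<xi> \<bullet> a))) * density_fourier \<phi> \<xi>"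
    unfolding density_fourier_def
    by (subst lborel_integral_affine[of _ 1 a])
       (auto simp: inner_add_right exp_add[symmetric] algebra_simps mult_exp_exp simp flip: integral_mult_right_zero)
  moreover have "density_fourier (\<lambda>v. \<phi> v - \<phi> (v - a)) \<xi> = density_fourier \<phi> \<xi> - density_fourier (\<lambda>v. \<phi> (v - a)) \<xi>"
    unfolding density_fourier_def
    using integrable_density_fourier[OF \<phi>, of \<xi>] integrable_density_fourier[OF sh, of \<xi>]
    by (simp add: right_diff_distrib)
  ultimately show "density_fourier (\<lambda>v. \<phi> v - \<phi> (v - a)) \<xi> = (1 - exp (- (\<i> * complex_of_real (\<xi> \<bullet> a)))) * density_fourier \<phi> \<xi>"
    by (simp add: algebra_simps)
qed

text \<open>Each difference \<open>\<phi>(v) - \<phi>(v - a)\<close> contributes a factor that vanishes at \<open>\<xi> = 0\<close>, so \<open>m\<close> differences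
  produce a zero of order at least \<open>m\<close> of the transform at the origin.\<close>

lemma exists_iterated_difference:
  fixes \<phi> :: "real ^ 'd \<Rightarrow> real"
  assumes \<phi>: "has_first_moment \<phi>"
  obtains \<psi> where "has_first_moment \<psi>"
    "\<And>\<xi>. density_fourier \<psi> \<xi> = (1 - exp (- (\<i> * complex_of_real (\<xi> \<bullet> a)))) ^ m * density_fourier \<phi> \<xi>"
proof -
  have "\<exists>\<psi>. has_first_moment \<psi> \<and>
    (\<forall>\<xi>. density_fourier \<psi> \<xi> = (1 - exp (- (\<i> * complex_of_real (\<xi> \<bullet> a)))) ^ m * density_fourier \<phi> \<xi>)"
  proof (induction m)
    case (Suc m)
    then obtain \<psi> where "has_first_moment \<psi>"
      "\<And>\<xi>. density_fourier \<psi> \<xi> = (1 - exp (- (\<i> * complex_of_real (\<xi> \<bullet> a)))) ^ m * density_fourier \<phi> \<xi>"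
      by blast
    then show ?case
      by (intro exI[of _ "\<lambda>v. \<psi> v - \<psi> (v - a)"])
         (auto simp: has_first_moment_difference density_fourier_difference)
  qed (use \<phi> in auto)
  then show ?thesis using that by blast
qed

section \<open>Gaussian concentration at a pair of frequencies\<close>

lemma fourier_integral_gaussian_real:
  fixes s :: real
  shows "integrable lborel (\<lambda>x. exp (- (\<i> * complex_of_real (s * x))) * complex_of_real (exp (- (x\<^sup>2) / 2)))"
    and "(\<integral>x. exp (- (\<i> * complex_of_real (s * x))) * complex_of_real (exp (- (x\<^sup>2) / 2)) \<partial>lborel)
       = complex_of_real (sqrt (2 * pi) * exp (- (s\<^sup>2) / 2))"
proof -
  have e: "exp (- (\<i> * complex_of_real (s * x))) * complex_of_real (exp (- (x\<^sup>2) / 2))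
     = complex_of_real (sqrt (2 * pi)) * (std_normal_density x *\<^sub>R iexp (- s * x))" for x
    by (simp add: std_normal_density_def scaleR_conv_of_real)
  have "integrable lborel (\<lambda>x. std_normal_density x *\<^sub>R iexp (- s * x))"
    by (rule Bochner_Integration.integrable_bound[OF integrable_normal_density[of 1 0]]) auto
  then show "integrable lborel (\<lambda>x. exp (- (\<i> * complex_of_real (s * x))) * complex_of_real (exp (- (x\<^sup>2) / 2)))"
    unfolding e by (rule integrable_mult_right)
  have "(\<integral>x. std_normal_density x *\<^sub>R iexp (- s * x) \<partial>lborel) = char std_normal_distribution (- s)"
    unfolding char_def by (subst integral_density) auto
  then show "(\<integral>x. exp (- (\<i> * complex_of_real (s * x))) * complex_of_real (exp (- (x\<^sup>2) / 2)) \<partial>lborel)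
       = complex_of_real (sqrt (2 * pi) * exp (- (s\<^sup>2) / 2))"
    unfolding e integral_mult_right_zero by (simp only: char_std_normal_distribution) simp
qed

text \<open>Gaussian and character both factor over the coordinates, which reduces the formula to the
  characteristic function of the standard normal distribution.\<close>

lemma density_fourier_gaussian:
  fixes \<xi> :: "real ^ 'd"
  shows "density_fourier (\<lambda>v. exp (- ((norm v)\<^sup>2) / 2)) \<xi>
       = complex_of_real (sqrt (2 * pi) ^ CARD('d) * exp (- ((norm \<xi>)\<^sup>2) / 2))"
proof -
  have sq: "exp (- ((norm v)\<^sup>2) / 2) = (\<Prod>b\<in>Basis. exp (- ((v \<bullet> b)\<^sup>2) / 2))" for v :: "real ^ 'd"
  proof -
    have "(norm v)\<^sup>2 = (\<Sum>b\<in>Basis. (v \<bullet> b)\<^sup>2)"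
      unfolding power2_norm_eq_inner by (subst euclidean_inner) (simp add: power2_eq_square)
    then show ?thesis by (simp add: exp_sum[symmetric] sum_negf sum_divide_distrib)
  qed
  have ex: "exp (- (\<i> * complex_of_real (\<xi> \<bullet> v))) = (\<Prod>b\<in>Basis. exp (- (\<i> * complex_of_real ((\<xi> \<bullet> b) * (v \<bullet> b)))))" for v
    by (subst euclidean_inner) (simp add: exp_sum[symmetric] sum_negf sum_distrib_left)
  have "density_fourier (\<lambda>v. exp (- ((norm v)\<^sup>2) / 2)) \<xi>
     = (\<integral>v. (\<Prod>b\<in>Basis. exp (- (\<i> * complex_of_real ((\<xi> \<bullet> b) * (v \<bullet> b)))) * complex_of_real (exp (- ((v \<bullet> b)\<^sup>2) / 2))) \<partial>lborel)"
    unfolding density_fourier_def sq ex by (simp add: prod.distrib)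
  also have "\<dots> = (\<Prod>b\<in>Basis. complex_of_real (sqrt (2 * pi) * exp (- ((\<xi> \<bullet> b)\<^sup>2) / 2)))"
    by (subst lborel_integral_prod[OF fourier_integral_gaussian_real(1)])
       (simp only: fourier_integral_gaussian_real(2))
  also have "\<dots> = complex_of_real (sqrt (2 * pi) ^ CARD('d) * exp (- ((norm \<xi>)\<^sup>2) / 2))"
    unfolding sq by (simp add: prod.distrib)
  finally show ?thesis .
qed

lemma density_fourier_gaussian_scaled:
  fixes \<xi> :: "real ^ 'd"
  assumes N: "0 < N"
  shows "density_fourier (\<lambda>v. exp (- ((norm v / N)\<^sup>2) / 2)) \<xi>
       = complex_of_real (sqrt (2 * pi) ^ CARD('d) * (N ^ CARD('d) * exp (- ((N * norm \<xi>)\<^sup>2) / 2)))"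
proof -
  have "density_fourier (\<lambda>v. exp (- ((norm v / N)\<^sup>2) / 2)) \<xi>
     = complex_of_real (N ^ CARD('d)) * density_fourier (\<lambda>v. exp (- ((norm v)\<^sup>2) / 2)) (N *\<^sub>R \<xi>)"
    unfolding density_fourier_def using N
    by (subst lborel_integral_affine[of _ N 0]) (auto simp: scaleR_conv_of_real[where 'a = complex])
  then show ?thesis using N unfolding density_fourier_gaussian by simp
qed

text \<open>Up to a constant factor, two approximate identities at scale \<open>1/N\<close>, centred at \<open>b\<close> and \<open>-b\<close>. The
  Fourier transform of a real density has even modulus, so a peak at \<open>b\<close> forces one at \<open>-b\<close>.\<close>

definition twin_peaks :: "real ^ 'd \<Rightarrow> real \<Rightarrow> real ^ 'd \<Rightarrow> real" where
  "twin_peaks b N \<xi> = N ^ CARD('d) * exp (- ((N * norm (\<xi> - b))\<^sup>2) / 2)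
                     + N ^ CARD('d) * exp (- ((N * norm (\<xi> + b))\<^sup>2) / 2)"

text \<open>Multiplication by \<open>cos (v \<bullet> b)\<close> averages the two frequency shifts by \<open>b\<close> and \<open>-b\<close>.\<close>

lemma
  fixes b :: "real ^ 'd"
  assumes N: "0 < N"
  defines "\<phi> \<equiv> \<lambda>v. exp (- ((norm v / N)\<^sup>2) / 2) * cos (v \<bullet> b)"
  shows has_first_moment_modulated_gaussian: "has_first_moment \<phi>"
    and density_fourier_modulated_gaussian:
      "density_fourier \<phi> \<xi> = complex_of_real (sqrt (2 * pi) ^ CARD('d) / 2 * twin_peaks b N \<xi>)"
proof -
  let ?g = "\<lambda>v::real ^ 'd. exp (- ((norm v / N)\<^sup>2) / 2)"
  have "?g v = exp (- (1 / (2 * N\<^sup>2)) * norm v powr 2)" for v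
    using N by (simp add: power_divide)
  then have g: "integrable lborel (\<lambda>v::real ^ 'd. norm v ^ k * ?g v)" for k
    using integrable_norm_pow_mult_exp[of "1 / (2 * N\<^sup>2)" 2 k, where 'a="real ^ 'd"] N by (simp only:) simp
  have "integrable lborel (\<lambda>v. norm v ^ k * \<phi> v)" for k
    by (rule Bochner_Integration.integrable_bound[OF g[of k]])
       (auto simp: \<phi>_def abs_mult intro!: AE_I2 mult_left_mono mult_left_le)
  from this[of 0] this[of 1] show fm: "has_first_moment \<phi>"
    by (simp add: has_first_moment_def)
  have gm: "has_first_moment ?g" using g[of 0] g[of 1] by (simp add: has_first_moment_def)
  have cosb: "complex_of_real (cos (v \<bullet> b)) = (exp (\<i> * complex_of_real (b \<bullet> v)) + exp (- (\<i> * complex_of_real (b \<bullet> v)))) / 2" for v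
    by (simp add: cos_of_real[symmetric] cos_exp_eq inner_commute)
  have "exp (- (\<i> * complex_of_real (\<xi> \<bullet> v))) * complex_of_real (\<phi> v)
      = (exp (- (\<i> * complex_of_real ((\<xi> - b) \<bullet> v))) * complex_of_real (?g v)
       + exp (- (\<i> * complex_of_real ((\<xi> + b) \<bullet> v))) * complex_of_real (?g v)) / 2" for v
    unfolding \<phi>_def of_real_mult cosb
    by (simp add: inner_add_left inner_diff_left exp_add exp_diff exp_minus field_simps)
  then have "density_fourier \<phi> \<xi> = (density_fourier ?g (\<xi> - b) + density_fourier ?g (\<xi> + b)) / 2"
    unfolding density_fourier_def
      Bochner_Integration.integral_add[OF integrable_density_fourier[OF gm] integrable_density_fourier[OF gm], symmetric]
      integral_divide_zero[symmetric]
    by (intro Bochner_Integration.integral_cong) auto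
  then show "density_fourier \<phi> \<xi> = complex_of_real (sqrt (2 * pi) ^ CARD('d) / 2 * twin_peaks b N \<xi>)"
    unfolding density_fourier_gaussian_scaled[OF N] twin_peaks_def
    by (simp add: field_simps)
qed

text \<open>After the substitution \<open>\<xi> = b + \<eta>/N\<close> with \<open>N = n + 1\<close> the Gaussian no longer depends on \<open>n\<close>, and dominated
  convergence applies.\<close>

lemma gaussian_concentration:
  fixes F :: "real ^ 'd \<Rightarrow> 'b::{banach, second_countable_topology}"
  assumes [measurable]: "F \<in> borel_measurable borel" and B: "\<And>\<xi>. norm (F \<xi>) \<le> B" and cont: "isCont F b"
  shows "integrable lborel (\<lambda>\<xi>. (real (Suc n) ^ CARD('d) * exp (- ((real (Suc n) * norm (\<xi> - b))\<^sup>2) / 2)) *\<^sub>R F \<xi>)"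
    and "(\<lambda>n. \<integral>\<xi>. (real (Suc n) ^ CARD('d) * exp (- ((real (Suc n) * norm (\<xi> - b))\<^sup>2) / 2)) *\<^sub>R F \<xi> \<partial>lborel)
       \<longlonglongrightarrow> (\<integral>(\<eta>::real ^ 'd). exp (- ((norm \<eta>)\<^sup>2) / 2) \<partial>lborel) *\<^sub>R F b"
proof -
  let ?g = "\<lambda>\<eta>::real ^ 'd. exp (- ((norm \<eta>)\<^sup>2) / 2)"
  have "?g = (\<lambda>v. exp (- (1 / 2) * norm v powr 2))" by auto
  then have g: "integrable lborel ?g"
    using integrable_norm_pow_mult_exp[of "1 / 2" 2 0, where 'a="real ^ 'd"] by simp
  have "integrable lborel (\<lambda>\<xi>. ?g ((- real (Suc n)) *\<^sub>R b + real (Suc n) *\<^sub>R \<xi>))"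
    by (rule lborel_integrable_affine[OF g]) simp
  moreover have "norm ((- real (Suc n)) *\<^sub>R b + real (Suc n) *\<^sub>R \<xi>) = real (Suc n) * norm (\<xi> - b)" for \<xi>
  proof -
    have "(- real (Suc n)) *\<^sub>R b + real (Suc n) *\<^sub>R \<xi> = real (Suc n) *\<^sub>R (\<xi> - b)" by (simp only: scaleR_diff_right scaleR_minus_left uminus_add_conv_diff)
    then show ?thesis by (simp only: norm_scaleR)
  qed
  ultimately have "integrable lborel (\<lambda>\<xi>. exp (- ((real (Suc n) * norm (\<xi> - b))\<^sup>2) / 2))"
    by simp
  then have "integrable lborel (\<lambda>\<xi>. B * (real (Suc n) ^ CARD('d) * exp (- ((real (Suc n) * norm (\<xi> - b))\<^sup>2) / 2)))"
    by (intro integrable_mult_right)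
  then show "integrable lborel (\<lambda>\<xi>. (real (Suc n) ^ CARD('d) * exp (- ((real (Suc n) * norm (\<xi> - b))\<^sup>2) / 2)) *\<^sub>R F \<xi>)"
  proof (rule Bochner_Integration.integrable_bound)
    have "B \<ge> 0" using B[of 0] norm_ge_zero order.trans by blast
    then show "AE \<xi> in lborel. norm ((real (Suc n) ^ CARD('d) * exp (- ((real (Suc n) * norm (\<xi> - b))\<^sup>2) / 2)) *\<^sub>R F \<xi>)
       \<le> norm (B * (real (Suc n) ^ CARD('d) * exp (- ((real (Suc n) * norm (\<xi> - b))\<^sup>2) / 2)))"
      using B by (auto simp: abs_mult mult.commute[of B] intro!: mult_left_mono)
  qed auto
  have eq: "(\<integral>\<xi>. (real (Suc n) ^ CARD('d) * exp (- ((real (Suc n) * norm (\<xi> - b))\<^sup>2) / 2)) *\<^sub>R F \<xi> \<partial>lborel)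
      = (\<integral>\<eta>. ?g \<eta> *\<^sub>R F (b + (1 / real (Suc n)) *\<^sub>R \<eta>) \<partial>lborel)" for n
  proof -
    have "real (Suc n) * norm (b + (1 / real (Suc n)) *\<^sub>R \<eta> - b) = norm \<eta>" for \<eta> by simp
    then show ?thesis
      by (subst lborel_integral_affine[of _ "1 / real (Suc n)" b])
         (auto simp del: of_nat_Suc integral_scaleR_right simp: power_divide simp flip: integral_scaleR_right)
  qed
  have "(\<lambda>n. \<integral>\<eta>. ?g \<eta> *\<^sub>R F (b + (1 / real (Suc n)) *\<^sub>R \<eta>) \<partial>lborel) \<longlonglongrightarrow> (\<integral>\<eta>. ?g \<eta> *\<^sub>R F b \<partial>lborel)"
  proof (rule integral_dominated_convergence[where w = "\<lambda>\<eta>. B * ?g \<eta>"])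
    show "integrable lborel (\<lambda>\<eta>. B * ?g \<eta>)" using g by simp
    show "AE \<eta> in lborel. (\<lambda>n. ?g \<eta> *\<^sub>R F (b + (1 / real (Suc n)) *\<^sub>R \<eta>)) \<longlonglongrightarrow> ?g \<eta> *\<^sub>R F b"
    proof (intro AE_I2 tendsto_intros isCont_tendsto_compose[OF cont])
      fix \<eta> :: "real ^ 'd"
      have "(\<lambda>n. b + (1 / real (Suc n)) *\<^sub>R \<eta>) \<longlonglongrightarrow> b + 0 *\<^sub>R \<eta>"
        using LIMSEQ_inverse_real_of_nat by (intro tendsto_intros) (simp add: inverse_eq_divide)
      then show "(\<lambda>n. b + (1 / real (Suc n)) *\<^sub>R \<eta>) \<longlonglongrightarrow> b" by simp
    qed
    show "AE \<eta> in lborel. norm (?g \<eta> *\<^sub>R F (b + (1 / real (Suc n)) *\<^sub>R \<eta>)) \<le> B * ?g \<eta>" for n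
      using B by (auto intro!: mult_left_mono simp: mult.commute[of B])
  qed auto
  then show "(\<lambda>n. \<integral>\<xi>. (real (Suc n) ^ CARD('d) * exp (- ((real (Suc n) * norm (\<xi> - b))\<^sup>2) / 2)) *\<^sub>R F \<xi> \<partial>lborel)
       \<longlonglongrightarrow> (\<integral>(\<eta>::real ^ 'd). exp (- ((norm \<eta>)\<^sup>2) / 2) \<partial>lborel) *\<^sub>R F b"
    unfolding eq integral_scaleR_left[OF g] .
qed

lemma twin_peaks_concentration:
  fixes F :: "real ^ 'd \<Rightarrow> 'b::{banach, second_countable_topology}"
  assumes "F \<in> borel_measurable borel" "\<And>\<xi>. norm (F \<xi>) \<le> B" "isCont F b" "isCont F (- b)"
  shows "integrable lborel (\<lambda>\<xi>. twin_peaks b (real (Suc n)) \<xi> *\<^sub>R F \<xi>)"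
    and "(\<lambda>n. \<integral>\<xi>. twin_peaks b (real (Suc n)) \<xi> *\<^sub>R F \<xi> \<partial>lborel)
       \<longlonglongrightarrow> (\<integral>(\<eta>::real ^ 'd). exp (- ((norm \<eta>)\<^sup>2) / 2) \<partial>lborel) *\<^sub>R (F b + F (- b))"
proof -
  note c1 = gaussian_concentration[OF assms(1-3)] and c2 = gaussian_concentration[OF assms(1,2,4), unfolded diff_minus_eq_add]
  show "integrable lborel (\<lambda>\<xi>. twin_peaks b (real (Suc n)) \<xi> *\<^sub>R F \<xi>)"
    unfolding twin_peaks_def scaleR_add_left by (intro Bochner_Integration.integrable_add c1 c2)
  show "(\<lambda>n. \<integral>\<xi>. twin_peaks b (real (Suc n)) \<xi> *\<^sub>R F \<xi> \<partial>lborel)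
       \<longlonglongrightarrow> (\<integral>(\<eta>::real ^ 'd). exp (- ((norm \<eta>)\<^sup>2) / 2) \<partial>lborel) *\<^sub>R (F b + F (- b))"
    unfolding twin_peaks_def scaleR_add_left scaleR_add_right
      Bochner_Integration.integral_add[OF c1(1) c2(1)]
    by (intro tendsto_add c1 c2)
qed

section \<open>Optimality of the constant\<close>

text \<open>The Fourier factor of \<open>d + 1\<close> differences with step \<open>\<pi>/r\<close> along the axis \<open>i\<close>. This step maximises
  each factor, with value \<open>1 - exp (\<plusminus>i\<pi>) = 2\<close>, at the frequencies \<open>\<plusminus>r\<close>.\<close>

definition difference_symbol :: "real \<Rightarrow> 'd \<Rightarrow> real ^ 'd \<Rightarrow> complex" where
  "difference_symbol r i \<xi> = (1 - exp (- (\<i> * complex_of_real (pi / r * \<xi> $ i)))) ^ (CARD('d) + 1)"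

lemma norm_difference_symbol_le:
  fixes \<xi> :: "real ^ 'd"
  assumes "0 < r"
  shows "norm (difference_symbol r i \<xi>) \<le> 2 ^ (CARD('d) + 1)"
    and "norm (difference_symbol r i \<xi>) \<le> (pi / r * norm \<xi>) ^ (CARD('d) + 1)"
proof -
  let ?z = "1 - exp (- (\<i> * complex_of_real (pi / r * \<xi> $ i)))"
  have "norm ?z \<le> norm (1::complex) + norm (exp (- (\<i> * complex_of_real (pi / r * \<xi> $ i))))"
    by (rule norm_triangle_ineq4)
  then have "norm ?z \<le> 2" by simp
  then show "norm (difference_symbol r i \<xi>) \<le> 2 ^ (CARD('d) + 1)"
    unfolding difference_symbol_def norm_power by (intro power_mono) auto
  have "norm ?z \<le> \<bar>pi / r * \<xi> $ i\<bar>"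
    using norm_iexp_minus_1_le[of "- (pi / r * \<xi> $ i)"] by (simp add: norm_minus_commute)
  also have "\<dots> \<le> pi / r * norm \<xi>"
    using assms component_le_norm_cart[of \<xi> i] by (simp add: abs_mult mult_left_mono divide_right_mono)
  finally show "norm (difference_symbol r i \<xi>) \<le> (pi / r * norm \<xi>) ^ (CARD('d) + 1)"
    unfolding difference_symbol_def norm_power by (intro power_mono) auto
qed

lemma difference_symbol_measurable [measurable]:
  "difference_symbol r i \<in> borel_measurable borel"
  unfolding difference_symbol_def[abs_def] by measurable

lemma isCont_difference_symbol: "isCont (difference_symbol r i) \<xi>"
  unfolding difference_symbol_def[abs_def] by (intro continuous_intros)

text \<open>Near the origin the zero of order \<open>d + 1\<close> compensates the singularity of order \<open>d + \<alpha>\<close>; away from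
  it both the symbol and the weight are bounded. Hence the integrand of \<open>\<rho>\<^sub>\<alpha>\<close> for the extremal family is
  a bounded function times \<open>twin_peaks\<close>, to which concentration applies.\<close>

lemma difference_symbol_over_powr_bounded:
  fixes \<xi> :: "real ^ 'd"
  assumes r: "0 < r" and \<alpha>: "0 < \<alpha>" "\<alpha> \<le> 1"
  shows "norm (difference_symbol r i \<xi>) / norm \<xi> powr (real CARD('d) + \<alpha>)
     \<le> (pi / r) ^ (CARD('d) + 1) + 2 ^ (CARD('d) + 1)"
proof (cases "\<xi> = 0")
  case False
  let ?m = "CARD('d) + 1"
  have pos: "0 < norm \<xi>" using False by simp
  show ?thesis
  proof (cases "norm \<xi> \<le> 1")
    case True
    have "norm \<xi> ^ ?m = norm \<xi> powr real ?m" by (rule powr_realpow[OF pos, symmetric])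
    also have "\<dots> \<le> norm \<xi> powr (real CARD('d) + \<alpha>)"
      using True \<alpha> pos by (intro powr_mono') auto
    finally have "(pi / r * norm \<xi>) ^ ?m \<le> (pi / r) ^ ?m * norm \<xi> powr (real CARD('d) + \<alpha>)"
      using r by (simp only: power_mult_distrib) (intro mult_left_mono, auto)
    with norm_difference_symbol_le(2)[OF r, of i \<xi>]
    have "norm (difference_symbol r i \<xi>) \<le> (pi / r) ^ ?m * norm \<xi> powr (real CARD('d) + \<alpha>)" by linarith
    then have "norm (difference_symbol r i \<xi>) / norm \<xi> powr (real CARD('d) + \<alpha>) \<le> (pi / r) ^ ?m"
      using pos by (simp add: divide_le_eq)
    then show ?thesis by (simp add: add_increasing2)
  next
    case False
    then have "1 \<le> norm \<xi> powr (real CARD('d) + \<alpha>)" using \<alpha> by (intro ge_one_powr_ge_zero) auto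
    then have "norm (difference_symbol r i \<xi>) / norm \<xi> powr (real CARD('d) + \<alpha>) \<le> norm (difference_symbol r i \<xi>)"
      by (simp add: divide_le_eq mult_le_cancel_left1 mult_right_mono)
    with norm_difference_symbol_le(1)[OF r, of i \<xi>] r show ?thesis by (simp add: add_increasing)
  qed
qed (use r in simp)

lemma difference_symbol_axis:
  assumes "0 < r"
  shows "difference_symbol r i (r *\<^sub>R axis i 1 :: real ^ 'd) = 2 ^ (CARD('d) + 1)"
    and "difference_symbol r i (- (r *\<^sub>R axis i 1) :: real ^ 'd) = 2 ^ (CARD('d) + 1)"
  using assms by (simp_all add: difference_symbol_def exp_minus exp_pi_i' exp_pi_i)

text \<open>Difference the Gaussian modulated by \<open>cos (r v\<^sub>i)\<close>, and split the resulting density of mass zero into two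
  probability measures. The factor \<open>q\<close> is immaterial, since the estimate to be tested is homogeneous in the
  difference of the data.\<close>

lemma exists_twin_peak_spectrum:
  fixes i :: "'d::finite"
  assumes r: "0 < r" and \<alpha>: "0 < \<alpha>" "\<alpha> \<le> 1" and N: "0 < N"
  obtains \<mu> \<nu> :: "(real ^ 'd) measure" and q where
    "\<mu> \<in> prob_moment \<alpha>" "\<nu> \<in> prob_moment \<alpha>" "0 < q"
    "\<And>\<xi>. fourier \<mu> \<xi> - fourier \<nu> \<xi>
       = complex_of_real (q * twin_peaks (r *\<^sub>R axis i 1) N \<xi>) * difference_symbol r i \<xi>"
proof -
  let ?b = "r *\<^sub>R axis i 1 :: real ^ 'd"
  obtain \<psi> where \<psi>: "has_first_moment \<psi>"
    and ft: "\<And>\<xi>. density_fourier \<psi> \<xi> = (1 - exp (- (\<i> * complex_of_real (\<xi> \<bullet> ((pi / r) *\<^sub>R axis i 1))))) ^ (CARD('d) + 1)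
       * complex_of_real (sqrt (2 * pi) ^ CARD('d) / 2 * twin_peaks ?b N \<xi>)"
    using exists_iterated_difference[OF has_first_moment_modulated_gaussian[OF N, of ?b]]
    unfolding density_fourier_modulated_gaussian[OF N] by blast
  have "density_fourier \<psi> 0 = 0" by (simp add: ft)
  then obtain \<mu> \<nu> c where "\<mu> \<in> prob_moment \<alpha>" "\<nu> \<in> prob_moment \<alpha>" "0 < c"
    and eq: "\<And>\<xi>. fourier \<mu> \<xi> - fourier \<nu> \<xi> = complex_of_real c * density_fourier \<psi> \<xi>"
    using signed_density_as_difference[OF \<psi> _ \<alpha>] by blast
  then show ?thesis
    by (intro that[of \<mu> \<nu> "c * (sqrt (2 * pi) ^ CARD('d) / 2)"])
       (auto simp: ft difference_symbol_def inner_axis mult_ac)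
qed

text \<open>Time \<open>t = 1\<close> and derivatives in one coordinate are enough. Applied to the measures of
  \<open>exists_twin_peak_spectrum\<close>, the assumed estimate compares two integrals against \<open>twin_peaks\<close>: of a
  function \<open>F\<close>, which carries the derivative at the point \<open>x\<close>, and of \<open>\<kappa>\<close>, which carries \<open>\<rho>\<^sub>\<alpha>\<close>. Letting the
  peaks sharpen leaves \<open>|F(b) + F(-b)| \<le> C (\<kappa>(b) + \<kappa>(-b))\<close>, and this is the claim, as \<open>|b| = r\<close> is
  the radius at which \<open>s\<^sup>a exp (- s\<^sup>p)\<close> is maximal.\<close>

lemma A_const_le_of_estimate:
  fixes i :: "'d::finite" and C :: real and k :: nat
  assumes p: "0 < p" and \<alpha>: "0 < \<alpha>" "\<alpha> \<le> 1"
  defines "\<sigma> \<equiv> \<lambda>j. if j = i then k else 0"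
  assumes est: "\<And>\<mu> \<nu> :: (real ^ 'd) measure. \<mu> \<in> prob_moment \<alpha> \<Longrightarrow> \<nu> \<in> prob_moment \<alpha> \<Longrightarrow>
      sup_norm (multi_deriv \<sigma> (\<lambda>x. heat_solution p \<mu> x 1 - heat_solution p \<nu> x 1)) \<le> ennreal C * rho \<alpha> \<mu> \<nu>"
  shows "A_const p \<alpha> \<sigma> \<le> C"
proof -
  \<comment> \<open>A negative \<open>C\<close> acts like \<open>0\<close> under \<open>ennreal\<close>; positivity of the constant excludes it in the end.\<close>
  define C' where "C' = max C 0"
  define a where "a = \<alpha> + real CARD('d) + real k"
  define r where "r = (a / p) powr (1 / p)"
  let ?K = "(2 * pi) powr (- real CARD('d))"
  let ?b = "r *\<^sub>R axis i 1 :: real ^ 'd"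
  let ?m = "CARD('d) + 1"
  let ?Z = "\<integral>(\<eta>::real ^ 'd). exp (- ((norm \<eta>)\<^sup>2) / 2) \<partial>lborel"
  have order: "multi_order \<sigma> = k" by (simp add: multi_order_def \<sigma>_def)
  have a: "0 < a" using \<alpha> by (simp add: a_def add_pos_nonneg)
  have r: "0 < r" using a p by (simp add: r_def)
  have nb: "norm ?b = r" using r by simp
  have b0: "?b \<noteq> 0" using nb r by force
  \<comment> \<open>As a function of \<open>\<xi>\<close>, \<open>exp (i x \<bullet> \<xi>)\<close> equals \<open>(-i)\<^sup>k\<close> at \<open>b\<close> and \<open>i\<^sup>k\<close> at \<open>-b\<close>; these values cancel the
    phases of \<open>(ir)\<^sup>k\<close> and \<open>(-ir)\<^sup>k\<close>.\<close>
  define x where "x = (- (real k * (pi / 2)) / r) *\<^sub>R (axis i 1 :: real ^ 'd)"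
  define w where "w = (difference_symbol r i :: real ^ 'd \<Rightarrow> complex)"
  define F where "F = (\<lambda>\<xi>. exp (\<i> * complex_of_real (x \<bullet> \<xi>)) * ((\<i> * complex_of_real (\<xi> $ i)) ^ k *
      (complex_of_real (?K * exp (- 1 * norm \<xi> powr p)) * w \<xi>)))"
  define \<kappa> where "\<kappa> = (\<lambda>\<xi>. norm (w \<xi>) / norm \<xi> powr (real CARD('d) + \<alpha>))"
  have [measurable]: "w \<in> borel_measurable borel" unfolding w_def by measurable
  have F_meas [measurable]: "F \<in> borel_measurable borel" unfolding F_def by measurable
  have \<kappa>_meas [measurable]: "\<kappa> \<in> borel_measurable borel" unfolding \<kappa>_def by measurable
  obtain B0 where B0: "\<And>s. s \<ge> 0 \<Longrightarrow> s ^ k * exp (- 1 * s powr p) \<le> B0"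
    using pow_mult_exp_bounded[of 1 p k] p by auto
  have F_bound: "norm (F \<xi>) \<le> ?K * (B0 * 2 ^ ?m)" for \<xi>
  proof -
    have "norm (F \<xi>) = \<bar>\<xi> $ i\<bar> ^ k * (?K * exp (- 1 * norm \<xi> powr p) * norm (w \<xi>))"
      by (simp add: F_def norm_mult norm_power)
    also have "\<dots> \<le> norm \<xi> ^ k * (?K * exp (- 1 * norm \<xi> powr p) * 2 ^ ?m)"
      unfolding w_def
      by (intro mult_mono power_mono component_le_norm_cart norm_difference_symbol_le(1)[OF r] order.refl) auto
    also have "\<dots> = ?K * ((norm \<xi> ^ k * exp (- 1 * norm \<xi> powr p)) * 2 ^ ?m)" by simp
    also have "\<dots> \<le> ?K * (B0 * 2 ^ ?m)" by (intro mult_left_mono mult_right_mono B0) auto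
    finally show ?thesis .
  qed
  have \<kappa>_bound: "norm (\<kappa> \<xi>) \<le> (pi / r) ^ ?m + 2 ^ ?m" for \<xi>
    using difference_symbol_over_powr_bounded[OF r \<alpha>, of i \<xi>] by (simp add: \<kappa>_def w_def)
  have w_cont: "isCont w \<xi>" for \<xi> unfolding w_def by (rule isCont_difference_symbol)
  have F_cont: "isCont F \<xi>" if "\<xi> \<noteq> 0" for \<xi>
    unfolding F_def by (intro continuous_intros w_cont) (use that in auto)
  have \<kappa>_cont: "isCont \<kappa> \<xi>" if "\<xi> \<noteq> 0" for \<xi>
    unfolding \<kappa>_def by (intro continuous_intros w_cont) (use that in auto)
  have F_at: "F ?b = complex_of_real (?K * r ^ k * exp (- (r powr p)) * 2 ^ ?m)"
       "F (- ?b) = complex_of_real (?K * r ^ k * exp (- (r powr p)) * 2 ^ ?m)"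
  proof -
    have half1: "exp (\<i> * complex_of_real (pi / 2)) = \<i>"
      by (metis cis_conv_exp cis_pi_half)
    have half2: "exp (- (\<i> * complex_of_real (pi / 2))) = - \<i>"
      unfolding exp_minus half1 by simp
    have xb: "x \<bullet> ?b = - (real k * (pi / 2))" using r by (simp add: x_def inner_axis_axis)
    have "exp (\<i> * complex_of_real (x \<bullet> ?b)) = exp (- (\<i> * complex_of_real (pi / 2))) ^ k"
      unfolding xb exp_of_nat_mult[symmetric] by (simp add: algebra_simps)
    then have e1: "exp (\<i> * complex_of_real (x \<bullet> ?b)) = (- \<i>) ^ k"
      unfolding half2 .
    have "exp (\<i> * complex_of_real (x \<bullet> (- ?b))) = exp (\<i> * complex_of_real (pi / 2)) ^ k"
      unfolding inner_minus_right xb exp_of_nat_mult[symmetric] by (simp add: algebra_simps)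
    then have e2: "exp (\<i> * complex_of_real (x \<bullet> (- ?b))) = \<i> ^ k"
      unfolding half1 .
    have c: "(- \<i>) ^ k * (\<i> * complex_of_real r) ^ k = complex_of_real (r ^ k)"
            "\<i> ^ k * (\<i> * complex_of_real (- r)) ^ k = complex_of_real (r ^ k)"
      by (simp_all flip: power_mult_distrib)
    have w: "w ?b = 2 ^ ?m" "w (- ?b) = 2 ^ ?m" unfolding w_def by (rule difference_symbol_axis[OF r])+
    have "F ?b = ((- \<i>) ^ k * (\<i> * complex_of_real r) ^ k) * complex_of_real (?K * exp (- (r powr p)) * 2 ^ ?m)"
      unfolding F_def e1 w nb by simp
    then show "F ?b = complex_of_real (?K * r ^ k * exp (- (r powr p)) * 2 ^ ?m)"
      unfolding c by simp
    have "F (- ?b) = (\<i> ^ k * (\<i> * complex_of_real (- r)) ^ k) * complex_of_real (?K * exp (- (r powr p)) * 2 ^ ?m)"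
      unfolding F_def e2 w norm_minus_cancel nb by simp
    then show "F (- ?b) = complex_of_real (?K * r ^ k * exp (- (r powr p)) * 2 ^ ?m)"
      unfolding c by simp
  qed
  have \<kappa>_at: "\<kappa> ?b = 2 ^ ?m / r powr (real CARD('d) + \<alpha>)" "\<kappa> (- ?b) = 2 ^ ?m / r powr (real CARD('d) + \<alpha>)"
    unfolding \<kappa>_def w_def difference_symbol_axis[OF r] norm_minus_cancel nb by (simp_all add: norm_power)
  note F_lim = twin_peaks_concentration[OF F_meas F_bound F_cont[OF b0] F_cont[of "- ?b"]]
  note \<kappa>_lim = twin_peaks_concentration[OF \<kappa>_meas \<kappa>_bound \<kappa>_cont[OF b0] \<kappa>_cont[of "- ?b"]]
  have mb0: "- ?b \<noteq> 0" using b0 by simp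
  let ?T = "\<lambda>n \<xi>. twin_peaks ?b (real (Suc n)) \<xi>"
  have ineq: "norm (\<integral>\<xi>. ?T n \<xi> *\<^sub>R F \<xi> \<partial>lborel) \<le> C' * (\<integral>\<xi>. ?T n \<xi> *\<^sub>R \<kappa> \<xi> \<partial>lborel)" for n
  proof -
    obtain \<mu> \<nu> :: "(real ^ 'd) measure" and q where \<mu>: "\<mu> \<in> prob_moment \<alpha>" and \<nu>: "\<nu> \<in> prob_moment \<alpha>" and q: "0 < q"
      and D: "\<And>\<xi>. fourier \<mu> \<xi> - fourier \<nu> \<xi> = complex_of_real (q * ?T n \<xi>) * w \<xi>"
      unfolding w_def using exists_twin_peak_spectrum[OF r \<alpha>, of "real (Suc n)" i] by auto
    have T0: "0 \<le> ?T n \<xi>" for \<xi> by (simp add: twin_peaks_def)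
    have G: "rapidly_decaying (heat_spectrum p 1 \<mu> \<nu>)"
      by (rule rapidly_decaying_heat_spectrum[OF _ p \<mu> \<nu>]) simp
    obtain js where js: "\<And>\<xi>. derivative_symbol js \<xi> = (\<Prod>j\<in>UNIV. (\<i> * complex_of_real (\<xi> $ j)) ^ \<sigma> j)"
      "multi_deriv \<sigma> (fourier_synthesis (heat_spectrum p 1 \<mu> \<nu>)) = fourier_synthesis (\<lambda>\<xi>. derivative_symbol js \<xi> * heat_spectrum p 1 \<mu> \<nu> \<xi>)"
      using multi_deriv_fourier_synthesis[OF G] by blast
    have sym: "derivative_symbol js \<xi> = (\<i> * complex_of_real (\<xi> $ i)) ^ k" for \<xi>
    proof -
      have "derivative_symbol js \<xi> = (\<Prod>j\<in>UNIV. if j = i then (\<i> * complex_of_real (\<xi> $ i)) ^ k else 1)"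
        unfolding js(1) \<sigma>_def by (intro prod.cong) auto
      then show ?thesis by simp
    qed
    have "fourier_synthesis (\<lambda>\<xi>. derivative_symbol js \<xi> * heat_spectrum p 1 \<mu> \<nu> \<xi>) x = (\<integral>\<xi>. q *\<^sub>R (?T n \<xi> *\<^sub>R F \<xi>) \<partial>lborel)"
      unfolding fourier_synthesis_def sym heat_spectrum_def D
      by (intro Bochner_Integration.integral_cong) (simp_all add: F_def scaleR_conv_of_real)
    then have v: "norm (fourier_synthesis (\<lambda>\<xi>. derivative_symbol js \<xi> * heat_spectrum p 1 \<mu> \<nu> \<xi>) x)
        = q * norm (\<integral>\<xi>. ?T n \<xi> *\<^sub>R F \<xi> \<partial>lborel)"
      using q by (simp only: integral_scaleR_right norm_scaleR abs_of_pos)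
    have "ennreal (q * norm (\<integral>\<xi>. ?T n \<xi> *\<^sub>R F \<xi> \<partial>lborel))
       \<le> sup_norm (multi_deriv \<sigma> (\<lambda>x. heat_solution p \<mu> x 1 - heat_solution p \<nu> x 1))"
      unfolding heat_difference_eq_fourier_synthesis[OF zero_less_one p \<mu> \<nu>] js(2) sup_norm_def v[symmetric]
      by (rule SUP_upper) simp
    also have "\<dots> \<le> ennreal C' * rho \<alpha> \<mu> \<nu>"
      using est[OF \<mu> \<nu>] by (simp add: C'_def)
    also have "rho \<alpha> \<mu> \<nu> = (\<integral>\<^sup>+\<xi>. ennreal (q * (?T n \<xi> *\<^sub>R \<kappa> \<xi>)) \<partial>lborel)"
      unfolding rho_def D using q T0
      by (intro nn_integral_cong) (simp add: norm_mult \<kappa>_def)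
    also have "\<dots> = ennreal (q * (\<integral>\<xi>. ?T n \<xi> *\<^sub>R \<kappa> \<xi> \<partial>lborel))"
    proof (subst nn_integral_eq_integral)
      show "integrable lborel (\<lambda>\<xi>. q * (?T n \<xi> *\<^sub>R \<kappa> \<xi>))"
        by (intro integrable_mult_right \<kappa>_lim(1)[OF mb0])
      show "AE \<xi> in lborel. 0 \<le> q * (?T n \<xi> *\<^sub>R \<kappa> \<xi>)"
        using q T0 by (simp add: \<kappa>_def)
    qed (simp only: integral_mult_right_zero)
    also have "ennreal C' * \<dots> = ennreal (C' * (q * (\<integral>\<xi>. ?T n \<xi> *\<^sub>R \<kappa> \<xi> \<partial>lborel)))"
      by (rule ennreal_mult'[symmetric]) (simp add: C'_def)
    finally have "q * norm (\<integral>\<xi>. ?T n \<xi> *\<^sub>R F \<xi> \<partial>lborel) \<le> C' * (q * (\<integral>\<xi>. ?T n \<xi> *\<^sub>R \<kappa> \<xi> \<partial>lborel))"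
      using q T0
      by (subst (asm) ennreal_le_iff)
         (auto simp: C'_def \<kappa>_def intro!: mult_nonneg_nonneg Bochner_Integration.integral_nonneg)
    then show ?thesis using q by (simp add: mult.left_commute[of C'])
  qed
  have "norm (?Z *\<^sub>R (F ?b + F (- ?b))) \<le> C' * (?Z *\<^sub>R (\<kappa> ?b + \<kappa> (- ?b)))"
    by (rule LIMSEQ_le[OF tendsto_norm[OF F_lim(2)[OF mb0]] tendsto_mult_left[OF \<kappa>_lim(2)[OF mb0]]]) (use ineq in auto)
  moreover have Z: "0 < ?Z"
  proof (rule lborel_integral_pos)
    show "integrable lborel (\<lambda>\<eta>::real ^ 'd. exp (- ((norm \<eta>)\<^sup>2) / 2))"
      using integrable_norm_pow_mult_exp[of "1 / 2" 2 0, where 'a="real ^ 'd"] by simp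
  qed simp
  ultimately have "norm (F ?b + F (- ?b)) \<le> C' * (\<kappa> ?b + \<kappa> (- ?b))"
    by (simp add: mult.left_commute[of C'])
  moreover have "norm (F ?b + F (- ?b)) = 2 * (?K * r ^ k * exp (- (r powr p)) * 2 ^ ?m)"
    unfolding F_at using r by (simp add: norm_mult norm_power flip: mult_2)
  ultimately have "(2 * 2 ^ ?m) * (?K * r ^ k * exp (- (r powr p))) \<le> (2 * 2 ^ ?m) * (C' / r powr (real CARD('d) + \<alpha>))"
    unfolding \<kappa>_at by (simp add: mult_ac)
  then have "?K * r ^ k * exp (- (r powr p)) \<le> C' / r powr (real CARD('d) + \<alpha>)"
    by (subst (asm) mult_le_cancel_left_pos) auto
  then have "?K * (r ^ k * r powr (real CARD('d) + \<alpha>) * exp (- (r powr p))) \<le> C'"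
    using r by (simp add: field_simps)
  also have "r ^ k * r powr (real CARD('d) + \<alpha>) = r powr a"
    using r by (simp add: a_def powr_realpow[symmetric] powr_add[symmetric] add_ac)
  also have "r powr a * exp (- (r powr p)) = (a / (exp 1 * p)) powr (a / p)"
    unfolding r_def by (rule powr_mult_exp_eq[OF a p])
  also have "?K * (a / (exp 1 * p)) powr (a / p) = A_const p \<alpha> \<sigma>"
    by (simp add: A_const_def order a_def)
  finally have "A_const p \<alpha> \<sigma> \<le> C'" .
  moreover have "0 < A_const p \<alpha> \<sigma>" by (rule A_const_pos[OF p \<alpha>(1)])
  ultimately show ?thesis by (auto simp: C'_def max_def split: if_splits)
qed

theorem proposition10p2:
  fixes p \<alpha> :: real and \<mu> \<nu> :: "(real ^ 'd) measure"
  assumes "0 < p" "p \<le> 2" "0 < \<alpha>" "\<alpha> < 1"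
    and "\<mu> \<in> prob_moment \<alpha>" "\<nu> \<in> prob_moment \<alpha>"
  shows "(\<forall>t>0. smooth (\<lambda>x. heat_solution p \<mu> x t - heat_solution p \<nu> x t)) \<and>
    (\<forall>\<sigma> :: 'd \<Rightarrow> nat. \<forall>t>0.
       sup_norm (multi_deriv \<sigma> (\<lambda>x. heat_solution p \<mu> x t - heat_solution p \<nu> x t))
         \<le> ennreal (A_const p \<alpha> \<sigma> * t powr (- (\<alpha> + real CARD('d) + real (multi_order \<sigma>)) / p))
             * rho \<alpha> \<mu> \<nu>) \<and>
    (\<forall>(\<sigma> :: 'd \<Rightarrow> nat) C.
       (\<forall>\<sigma>' :: 'd \<Rightarrow> nat. \<forall>\<mu>' \<in> prob_moment \<alpha>. \<forall>\<nu>' \<in> prob_moment \<alpha>. \<forall>t>0.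
          multi_order \<sigma>' = multi_order \<sigma> \<longrightarrow>
          sup_norm (multi_deriv \<sigma>' (\<lambda>x. heat_solution p \<mu>' x t - heat_solution p \<nu>' x t))
            \<le> ennreal (C * t powr (- (\<alpha> + real CARD('d) + real (multi_order \<sigma>')) / p))
                * rho \<alpha> \<mu>' \<nu>')
       \<longrightarrow> A_const p \<alpha> \<sigma> \<le> C)"
proof (intro conjI allI impI)
  fix t :: real assume t: "0 < t"
  show "smooth (\<lambda>x. heat_solution p \<mu> x t - heat_solution p \<nu> x t)"
    unfolding heat_difference_eq_fourier_synthesis[OF t assms(1,5,6)]
    by (rule smooth_fourier_synthesis) (rule rapidly_decaying_heat_spectrum[OF t assms(1,5,6)])
next
  fix \<sigma> :: "'d \<Rightarrow> nat" and t :: real assume "0 < t"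
  then show "sup_norm (multi_deriv \<sigma> (\<lambda>x. heat_solution p \<mu> x t - heat_solution p \<nu> x t))
         \<le> ennreal (A_const p \<alpha> \<sigma> * t powr (- (\<alpha> + real CARD('d) + real (multi_order \<sigma>)) / p)) * rho \<alpha> \<mu> \<nu>"
    by (intro sup_norm_multi_deriv_le assms)
next
  fix \<sigma> :: "'d \<Rightarrow> nat" and C :: real
  assume est: "\<forall>\<sigma>' :: 'd \<Rightarrow> nat. \<forall>\<mu>' \<in> prob_moment \<alpha>. \<forall>\<nu>' \<in> prob_moment \<alpha>. \<forall>t>0.
          multi_order \<sigma>' = multi_order \<sigma> \<longrightarrow>
          sup_norm (multi_deriv \<sigma>' (\<lambda>x. heat_solution p \<mu>' x t - heat_solution p \<nu>' x t))
            \<le> ennreal (C * t powr (- (\<alpha> + real CARD('d) + real (multi_order \<sigma>')) / p)) * rho \<alpha> \<mu>' \<nu>'"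
  \<comment> \<open>The constant depends on \<open>\<sigma>\<close> only through its order, so all derivatives may be moved to one
    coordinate.\<close>
  define i :: 'd where "i = undefined"
  define \<sigma>' where "\<sigma>' = (\<lambda>j. if j = i then multi_order \<sigma> else 0)"
  have order: "multi_order \<sigma>' = multi_order \<sigma>"
    unfolding multi_order_def[of \<sigma>'] by (simp add: \<sigma>'_def)
  have "A_const p \<alpha> \<sigma>' \<le> C"
    unfolding \<sigma>'_def
  proof (rule A_const_le_of_estimate)
    fix \<mu>' \<nu>' :: "(real ^ 'd) measure"
    assume "\<mu>' \<in> prob_moment \<alpha>" "\<nu>' \<in> prob_moment \<alpha>"
    from est[rule_format, OF this zero_less_one order]
    show "sup_norm (multi_deriv (\<lambda>j. if j = i then multi_order \<sigma> else 0) (\<lambda>x. heat_solution p \<mu>' x 1 - heat_solution p \<nu>' x 1))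
        \<le> ennreal C * rho \<alpha> \<mu>' \<nu>'"
      by (simp add: \<sigma>'_def)
  qed (use assms in auto)
  then show "A_const p \<alpha> \<sigma> \<le> C" by (simp add: A_const_def order)
qed

end
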